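(* Let $I=(-1,1)$, $y_d\in L_2(I)$, $\beta>0$, and assume that $f\in H^1(I)$, $\psi\in H^2(I)$ and $\psi(1)\geq 0$. Let $V=\{v\in H^2(I): v(-1)=v'(1)=0\}$ and $K=\{y\in V: y'\leq\psi\text{ on }I\}$, and let $\bar y\in K$ be the (unique) solution of the variational inequality $$\int_I(\bar y-y_d)(y-\bar y)\,dx+\beta\int_I(\bar y''+f)(y''-\bar y'')\,dx\geq 0\qquad\forall\,y\in K.$$ Then $\bar y\in H^3(I)$.
   Context: $H^s(I)$ denotes the $L_2$-based Sobolev space. The variational inequality characterizes the unique minimizer over $y\in K$ of $\frac12\big[\|y-y_d\|_{L_2(I)}^2+\beta\|y''+f\|_{L_2(I)}^2\big]$. *)

theory Defs
  imports "HOL-Analysis.Analysis"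
begin

text \<open>
  Elements of \<open>L\<^sub>2(S)\<close> and \<open>H\<^sup>k(S)\<close> are represented by functions on the reals; only the values on
  \<open>S\<close>, up to null sets, are relevant. Nothing below depends on the choice of the representative.
\<close>

definition L2_space :: "real set \<Rightarrow> (real \<Rightarrow> real) set" where
  "L2_space S = {u \<in> borel_measurable (lebesgue_on S). integrable (lebesgue_on S) (\<lambda>x. (u x)\<^sup>2)}"

definition test_functions :: "real set \<Rightarrow> (real \<Rightarrow> real) set" where
  "test_functions S = {\<phi>. (\<forall>n x. (deriv ^^ n) \<phi> differentiable (at x)) \<and>
     compact (closure {x. \<phi> x \<noteq> 0}) \<and> closure {x. \<phi> x \<noteq> 0} \<subseteq> S}"

definition has_weak_deriv :: "real set \<Rightarrow> nat \<Rightarrow> (real \<Rightarrow> real) \<Rightarrow> (real \<Rightarrow> real) \<Rightarrow> bool" where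
  "has_weak_deriv S k u g \<longleftrightarrow> g \<in> L2_space S \<and>
     (\<forall>\<phi>\<in>test_functions S.
        (LINT x|lebesgue_on S. u x * (deriv ^^ k) \<phi> x) = (-1) ^ k * (LINT x|lebesgue_on S. g x * \<phi> x))"

definition sobolev_H :: "nat \<Rightarrow> real set \<Rightarrow> (real \<Rightarrow> real) set" where
  "sobolev_H k S = {u \<in> L2_space S. \<forall>j\<le>k. \<exists>g. has_weak_deriv S j u g}"

text \<open>
  For open \<open>S\<close> the weak derivative is unique up to null sets, so the choice is immaterial.
\<close>

definition weak_deriv :: "real set \<Rightarrow> nat \<Rightarrow> (real \<Rightarrow> real) \<Rightarrow> (real \<Rightarrow> real)" where
  "weak_deriv S k u = (SOME g. has_weak_deriv S k u g)"

text \<open>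
  Point values of Sobolev functions, on \<open>S\<close> and at its boundary, are those of the representative
  that is continuous up to the boundary. On a nonempty bounded open interval it exists for every
  element of \<open>H\<^sup>1\<close> and its values on the closure are unique.
\<close>

definition cont_rep :: "real set \<Rightarrow> (real \<Rightarrow> real) \<Rightarrow> (real \<Rightarrow> real)" where
  "cont_rep S u = (SOME g. continuous_on (closure S) g \<and> (AE x in lebesgue_on S. g x = u x))"

end

theory Submission
  imports Defs
begin

text \<open>
  Put \<open>p = y'\<close> for the solution \<open>y\<close> and \<open>w = p - \<psi> \<le> 0\<close>. Two
  integrations by parts move the lower order term of the inequality onto the second derivative \<open>e\<close> of the
  variation: with \<open>\<Phi>(x)\<close> the integral of \<open>y - y\<^sub>d\<close> over \<open>[x,1]\<close>,
  \<open>\<Phi>1\<close> a primitive of \<open>\<Phi>\<close>, and \<open>g = y'' + f - \<Phi>1/\<beta>\<close>, it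
  says that the integral of \<open>g e\<close> is nonnegative whenever \<open>e\<close> is in
  \<open>L\<^sub>2\<close>, has integral zero, and \<open>p\<close> plus the primitive of \<open>e\<close> that
  vanishes at \<open>-1\<close> stays below \<open>\<psi>\<close>. Since \<open>f\<close> and \<open>\<Phi>1\<close>
  are in \<open>H\<^sup>1\<close>, it suffices that \<open>g\<close> has a weak derivative in
  \<open>L\<^sub>2\<close>.

  The slopes of piecewise linear hat functions are the only \<open>e\<close> that are needed. Subtracting a hat
  from \<open>p\<close> is always admissible; it shows that the means of \<open>g\<close> over adjacent intervals increase,
  that is, the primitive \<open>\<Gamma>\<close> of \<open>g\<close> is convex. Adding a small hat is admissible where \<open>w < 0\<close>; so
  \<open>\<Gamma>\<close> is affine on each interval of noncontact. On the other hand \<open>w' = g - h\<close> almost everywhere,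
  where \<open>h = \<psi>' + f - \<Phi>1/\<beta>\<close> is in \<open>H\<^sup>1\<close>, with derivative \<open>k\<close>, say. So the convex \<open>\<Gamma>\<close> lies, up to a
  constant, below the \<open>C\<^sup>1\<close> function with derivative \<open>h\<close> and touches it at the contact points.
  Convexity and contact from below force the slope of \<open>\<Gamma>\<close> at a contact point to be \<open>h\<close>, from both
  sides. Hence \<open>g = h\<close> almost everywhere on the contact set, and on a component of the noncontact
  set \<open>g\<close> is a constant that equals \<open>h\<close> at each endpoint inside \<open>I\<close>. Therefore \<open>h - g\<close> is \<open>h - s\<close>,
  vanishing at the endpoints, on each component, and zero elsewhere; integrating by parts on each
  component and summing over the countably many components shows that the weak derivative of \<open>g\<close> is
  \<open>k\<close> on the contact set and \<open>0\<close> off it (lemma \<open>obstacle_weak_derivative\<close>).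
  This is in \<open>L\<^sub>2\<close> because \<open>k\<close> is.

  Weak derivatives are tied to primitives by the du Bois-Reymond lemma, which rests on smooth bump
  functions built from \<open>exp (- 1 / x)\<close>, and in the converse direction by Fubini's theorem (lemma
  \<open>primitive_product\<close>). Integrals over subintervals are Henstock-Kurzweil integrals, which agree with
  the Lebesgue integrals for integrable functions.
\<close>

section \<open>Smooth test functions\<close>

definition smooth :: "(real \<Rightarrow> real) \<Rightarrow> bool" where
  "smooth \<phi> \<longleftrightarrow> (\<forall>n x. (deriv ^^ n) \<phi> differentiable (at x))"

text \<open>
  Coinduction: membership in a family that is closed under taking derivatives gives all higher
  derivatives at once. The closure properties of smooth functions below only need a suitable family.
\<close>

lemma smooth_coinduct:
  assumes "f \<in> A" and closed: "\<And>f. f \<in> A \<Longrightarrow> \<exists>f'\<in>A. \<forall>x. (f has_real_derivative f' x) (at x)"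
  shows "smooth f"
proof -
  have "(deriv ^^ n) f \<in> A" for n
  proof (induction n)
    case (Suc n)
    then obtain f' where f': "f' \<in> A" "\<forall>x. ((deriv ^^ n) f has_real_derivative f' x) (at x)"
      using closed by blast
    then have "deriv ((deriv ^^ n) f) = f'"
      by (auto simp: DERIV_imp_deriv)
    with f' show ?case by simp
  qed (use assms in simp)
  then show ?thesis
    unfolding smooth_def using closed real_differentiable_def by blast
qed

lemma smooth_has_deriv: "smooth f \<Longrightarrow> (f has_real_derivative deriv f x) (at x)"
  unfolding smooth_def by (metis DERIV_deriv_iff_real_differentiable funpow_0)

lemma smooth_deriv: "smooth f \<Longrightarrow> smooth (deriv f)"
  unfolding smooth_def by (metis comp_apply funpow_Suc_right)

lemma smooth_if_deriv_smooth:
  assumes "smooth g" "\<And>x. (f has_real_derivative g x) (at x)"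
  shows "smooth f"
proof (rule smooth_coinduct)
  show "f \<in> insert f {h. smooth h}" by simp
qed (use assms smooth_deriv smooth_has_deriv in \<open>blast+\<close>)

lemma smooth_lincomb:
  assumes "smooth f" "smooth g" shows "smooth (\<lambda>x. c * f x + d * g x)"
proof (rule smooth_coinduct)
  show "(\<lambda>x. c * f x + d * g x) \<in> {h. \<exists>f g. smooth f \<and> smooth g \<and> h = (\<lambda>x. c * f x + d * g x)}"
    using assms by blast
next
  fix h assume "h \<in> {h. \<exists>f g. smooth f \<and> smooth g \<and> h = (\<lambda>x. c * f x + d * g x)}"
  then obtain f g where "smooth f" "smooth g" "h = (\<lambda>x. c * f x + d * g x)" by blast
  then show "\<exists>h'\<in>{h. \<exists>f g. smooth f \<and> smooth g \<and> h = (\<lambda>x. c * f x + d * g x)}.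
      \<forall>x. (h has_real_derivative h' x) (at x)"
    by (intro bexI[of _ "\<lambda>x. c * deriv f x + d * deriv g x"])
      (auto intro!: DERIV_add DERIV_cmult smooth_has_deriv smooth_deriv
        intro: exI[of _ "deriv f"] exI[of _ "deriv g"] smooth_deriv)
qed

text \<open>
  The Leibniz rule turns one product into a sum of two, so the family closed under derivatives that
  contains the products consists of finite sums of products.
\<close>

inductive_set product_sums :: "(real \<Rightarrow> real) set" where
  prod: "smooth f \<Longrightarrow> smooth g \<Longrightarrow> (\<lambda>x. f x * g x) \<in> product_sums"
| add: "f \<in> product_sums \<Longrightarrow> g \<in> product_sums \<Longrightarrow> (\<lambda>x. f x + g x) \<in> product_sums"

lemma smooth_mult:
  assumes "smooth f" "smooth g" shows "smooth (\<lambda>x. f x * g x)"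
proof (rule smooth_coinduct)
  show "(\<lambda>x. f x * g x) \<in> product_sums"
    using assms by (rule product_sums.prod)
next
  fix h assume "h \<in> product_sums"
  then show "\<exists>h'\<in>product_sums. \<forall>x. (h has_real_derivative h' x) (at x)"
  proof induction
    case (prod f g)
    have "(\<lambda>x. (deriv f x * g x) + (f x * deriv g x)) \<in> product_sums"
      by (intro product_sums.intros smooth_deriv prod)
    moreover have "((\<lambda>x. f x * g x) has_real_derivative deriv f x * g x + f x * deriv g x) (at x)" for x
      using prod by (auto intro!: derivative_eq_intros smooth_has_deriv)
    ultimately show ?case by (intro bexI) auto
  next
    case (add f g)
    then obtain f' g' where "f' \<in> product_sums" "g' \<in> product_sums"
      "\<forall>x. (f has_real_derivative f' x) (at x)" "\<forall>x. (g has_real_derivative g' x) (at x)" by blast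
    then show ?case
      by (intro bexI[of _ "\<lambda>x. f' x + g' x"]) (auto intro!: derivative_eq_intros product_sums.add)
  qed
qed

lemma smooth_affine:
  assumes "smooth f" shows "smooth (\<lambda>x. f (m * x + c))"
proof (rule smooth_coinduct)
  show "(\<lambda>x. f (m * x + c)) \<in> {h. \<exists>f k. smooth f \<and> h = (\<lambda>x. k * f (m * x + c))}"
    using assms by (auto intro!: exI[of _ f] exI[of _ 1])
next
  fix h assume "h \<in> {h. \<exists>f k. smooth f \<and> h = (\<lambda>x. k * f (m * x + c))}"
  then obtain f k where f: "smooth f" and h: "h = (\<lambda>x. k * f (m * x + c))" by blast
  have "(h has_real_derivative (k * m) * deriv f (m * x + c)) (at x)" for x
    unfolding h
  proof -
    have "((\<lambda>x. m * x + c) has_real_derivative m) (at x)"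
      by (auto intro!: derivative_eq_intros)
    from DERIV_cmult[OF DERIV_chain2[OF smooth_has_deriv[OF f] this]]
    show "((\<lambda>x. k * f (m * x + c)) has_real_derivative (k * m) * deriv f (m * x + c)) (at x)"
      by (simp add: mult_ac)
  qed
  moreover have "(\<lambda>x. (k * m) * deriv f (m * x + c)) \<in> {h. \<exists>f k. smooth f \<and> h = (\<lambda>x. k * f (m * x + c))}"
    using smooth_deriv[OF f] by blast
  ultimately show "\<exists>h'\<in>{h. \<exists>f k. smooth f \<and> h = (\<lambda>x. k * f (m * x + c))}.
      \<forall>x. (h has_real_derivative h' x) (at x)"
    by (intro bexI[rotated]) auto
qed

text \<open>
  The functions \<open>p (1 / x) exp (- 1 / x)\<close>, extended by zero to the left half line, form a family
  that is closed under derivatives; the classical flat function is \<open>flat 1\<close>.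
\<close>

definition flat :: "real poly \<Rightarrow> real \<Rightarrow> real" where
  "flat p x = (if x \<le> 0 then 0 else poly p (inverse x) * exp (- inverse x))"

lemma poly_times_exp_minus_tendsto_0:
  "((\<lambda>y. poly p y * exp (- y)) \<longlongrightarrow> (0::real)) at_top"
proof -
  have "((\<lambda>y::real. \<Sum>i\<le>degree p. coeff p i * (y ^ i / exp y)) \<longlongrightarrow> (\<Sum>i\<le>degree p. coeff p i * 0)) at_top"
    by (intro tendsto_sum tendsto_mult tendsto_const tendsto_power_div_exp_0)
  then show ?thesis
    by (simp add: poly_altdef sum_distrib_right exp_minus divide_inverse mult.assoc)
qed

text \<open>
  For \<open>x > 0\<close> this is the chain rule. At \<open>0\<close> the difference quotient is a polynomial in \<open>y = 1 / x\<close>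
  times \<open>exp (- y)\<close>, which tends to zero.
\<close>

lemma flat_has_deriv:
  "(flat p has_real_derivative flat ([:0, 0, 1:] * (p - pderiv p)) x) (at x)"
proof -
  consider "x < 0" | "x = 0" | "x > 0" by linarith
  then show ?thesis
  proof cases
    case 1
    have "((\<lambda>x. 0) has_real_derivative 0) (at x)" by simp
    then have "(flat p has_real_derivative 0) (at x)"
      by (rule has_field_derivative_transform_within_open[where S="{..<0}"]) (use 1 in \<open>auto simp: flat_def\<close>)
    with 1 show ?thesis by (simp add: flat_def)
  next
    case 3
    have inv: "(inverse has_real_derivative - (inverse x * inverse x)) (at x)"
      using DERIV_inverse[of x] 3 by (simp add: numeral_2_eq_2)
    have "((\<lambda>x. poly p (inverse x) * exp (- inverse x)) has_real_derivative
        poly (pderiv p) (inverse x) * (- (inverse x * inverse x)) * exp (- inverse x)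
        + exp (- inverse x) * (- (- (inverse x * inverse x))) * poly p (inverse x)) (at x)"
      by (intro DERIV_mult DERIV_chain2[OF poly_DERIV inv] DERIV_chain2[OF DERIV_exp] DERIV_minus inv)
    also have "poly (pderiv p) (inverse x) * (- (inverse x * inverse x)) * exp (- inverse x)
        + exp (- inverse x) * (- (- (inverse x * inverse x))) * poly p (inverse x)
        = flat ([:0, 0, 1:] * (p - pderiv p)) x"
      using 3 by (simp add: flat_def algebra_simps)
    finally show ?thesis
      by (rule has_field_derivative_transform_within_open[where S="{0<..}"]) (use 3 in \<open>auto simp: flat_def\<close>)
  next
    case 2
    have "((\<lambda>h. flat p h / h) \<longlongrightarrow> 0) (at_right 0)"
    proof -
      have "((\<lambda>h. poly ([:0, 1:] * p) (inverse h) * exp (- inverse h)) \<longlongrightarrow> (0::real)) (at_right 0)"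
        using poly_times_exp_minus_tendsto_0 filterlim_inverse_at_top_right by (rule filterlim_compose)
      then show ?thesis
        by (rule Lim_transform_eventually)
          (auto simp: eventually_at_filter flat_def field_simps)
    qed
    moreover have "((\<lambda>h. flat p h / h) \<longlongrightarrow> 0) (at_left 0)"
    proof -
      have "((\<lambda>h::real. 0) \<longlongrightarrow> (0::real)) (at_left 0)" by simp
      then show ?thesis
        by (rule Lim_transform_eventually) (auto simp: eventually_at_filter flat_def)
    qed
    ultimately have "((\<lambda>h. flat p h / h) \<longlongrightarrow> 0) (at 0)"
      by (rule filterlim_split_at[rotated])
    then show ?thesis
      using 2 by (simp add: DERIV_def flat_def[of _ 0])
  qed
qed

lemma smooth_flat: "smooth (flat p)"
  by (rule smooth_coinduct[of _ "range flat"]) (use flat_has_deriv in blast)+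

text \<open>
  Powers of the flat function are rescalings of it: \<open>exp (- 1 / x)\<close> to the power \<open>1 / m\<close> is
  \<open>exp (- 1 / (m x))\<close>. Hence these functions, supported in \<open>[c,d]\<close>, increase to the indicator function
  of \<open>(c,d)\<close> as \<open>m\<close> grows, and no mollification is needed to approximate it.
\<close>

definition bump :: "real \<Rightarrow> real \<Rightarrow> real \<Rightarrow> real \<Rightarrow> real" where
  "bump c d m x = flat 1 (m * (x - c)) * flat 1 (m * (d - x))"

lemma smooth_bump: "smooth (bump c d m)"
proof -
  have "smooth (\<lambda>x. flat 1 (m * x + (- m * c)) * flat 1 ((- m) * x + m * d))"
    by (intro smooth_mult smooth_affine smooth_flat)
  then show ?thesis
    by (simp add: bump_def[abs_def] algebra_simps)
qed

lemma bump_eq_0: "m > 0 \<Longrightarrow> x \<notin> {c<..<d} \<Longrightarrow> bump c d m x = 0"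
  by (auto simp: bump_def flat_def not_less mult_nonneg_nonpos zero_less_mult_iff not_le)

lemma bump_pos: "m > 0 \<Longrightarrow> x \<in> {c<..<d} \<Longrightarrow> bump c d m x > 0"
  by (auto simp: bump_def flat_def mult_le_0_iff)

lemma bump_bounded: "0 \<le> bump c d m x" "bump c d m x \<le> 1"
proof -
  have "0 \<le> flat 1 y" "flat 1 y \<le> 1" for y
    by (auto simp: flat_def)
  then show "0 \<le> bump c d m x" "bump c d m x \<le> 1"
    unfolding bump_def by (auto intro!: mult_le_one)
qed

lemma bump_tendsto: "(\<lambda>n. bump c d (real (Suc n)) x) \<longlonglongrightarrow> indicator {c<..<d} x"
proof (cases "x \<in> {c<..<d}")
  case True
  have *: "(\<lambda>n. flat 1 (real (Suc n) * y)) \<longlonglongrightarrow> 1" if "y > 0" for y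
  proof -
    have "(\<lambda>n. exp (- (inverse (real (Suc n)) * inverse y))) \<longlonglongrightarrow> exp (- (0 * inverse y))"
      by (intro tendsto_intros LIMSEQ_inverse_real_of_nat)
    then show ?thesis
      using that by (simp add: flat_def mult_le_0_iff)
  qed
  have "(\<lambda>n. bump c d (real (Suc n)) x) \<longlonglongrightarrow> 1 * 1"
    unfolding bump_def by (intro tendsto_mult *) (use True in auto)
  with True show ?thesis by simp
next
  case False
  then show ?thesis by (simp add: bump_eq_0 del: greaterThanLessThan_iff)
qed

lemma test_functions_intro:
  assumes "smooth \<phi>" "{c..d} \<subseteq> S" "\<And>x. x \<notin> {c..d} \<Longrightarrow> \<phi> x = 0"
  shows "\<phi> \<in> test_functions S"
proof -
  have sub: "closure {x. \<phi> x \<noteq> 0} \<subseteq> {c..d}"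
  proof (rule closure_minimal)
    show "{x. \<phi> x \<noteq> 0} \<subseteq> {c..d}" using assms(3) by blast
  qed simp
  then have "compact (closure {x. \<phi> x \<noteq> 0})"
    by (simp add: compact_eq_bounded_closed bounded_subset[OF bounded_closed_interval])
  with sub assms show ?thesis
    unfolding test_functions_def smooth_def by auto
qed

lemma test_functions_smooth: "\<phi> \<in> test_functions S \<Longrightarrow> smooth \<phi>"
  by (auto simp: test_functions_def smooth_def)

text \<open>
  A support interval \<open>[c,d]\<close> in the open interval, nondegenerate even if the function vanishes.
\<close>

lemma test_functions_support:
  assumes "\<phi> \<in> test_functions {a<..<b}" "a < b"
  obtains c d where "a < c" "c < d" "d < b" "\<And>x. x \<notin> {c..d} \<Longrightarrow> \<phi> x = 0"
proof -
  define T where "T = closure {x. \<phi> x \<noteq> 0} \<union> {(a+b)/2}"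
  have T: "compact T" "T \<subseteq> {a<..<b}" "T \<noteq> {}"
    using assms by (auto simp: T_def test_functions_def)
  obtain u where u: "u \<in> T" "\<forall>t\<in>T. u \<le> t" using compact_attains_inf[OF T(1,3)] by blast
  obtain v where v: "v \<in> T" "\<forall>t\<in>T. t \<le> v" using compact_attains_sup[OF T(1,3)] by blast
  have uv: "a < u" "u \<le> v" "v < b" using u v T by auto
  show thesis
  proof (rule that[of "(a+u)/2" "(v+b)/2"])
    fix x assume "x \<notin> {(a+u)/2..(v+b)/2}"
    then have "x \<notin> T" using u v uv by fastforce
    then show "\<phi> x = 0" unfolding T_def using closure_subset[of "{x. \<phi> x \<noteq> 0}"] by blast
  qed (use uv in auto)
qed

lemma test_functions_deriv:
  assumes "\<phi> \<in> test_functions {a<..<b}" "a < b"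
  shows "deriv \<phi> \<in> test_functions {a<..<b}"
proof -
  obtain c d where cd: "a < c" "c < d" "d < b" "\<And>x. x \<notin> {c..d} \<Longrightarrow> \<phi> x = 0"
    using test_functions_support[OF assms] by blast
  show ?thesis
  proof (rule test_functions_intro)
    show "smooth (deriv \<phi>)" using assms test_functions_smooth smooth_deriv by blast
    show "{c..d} \<subseteq> {a<..<b}" using cd by auto
    fix x assume x: "x \<notin> {c..d}"
    have "((\<lambda>x. 0) has_real_derivative 0) (at x)" by simp
    then have "(\<phi> has_real_derivative 0) (at x)"
      by (rule has_field_derivative_transform_within_open[where S="- {c..d}"])
         (use x cd in \<open>auto simp: open_Compl\<close>)
    then show "deriv \<phi> x = 0" by (rule DERIV_imp_deriv)
  qed
qed

lemma test_functions_zero_outside: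
  "\<phi> \<in> test_functions S \<Longrightarrow> x \<notin> S \<Longrightarrow> \<phi> x = 0"
  unfolding test_functions_def using closure_subset[of "{x. \<phi> x \<noteq> 0}"] by blast

lemma test_functions_continuous: "\<phi> \<in> test_functions S \<Longrightarrow> continuous_on T \<phi>"
  by (rule continuous_at_imp_continuous_on) (use test_functions_smooth smooth_has_deriv DERIV_isCont in blast)

section \<open>Integrable functions on an interval and their primitives\<close>

lemma integrable_lebesgue_on_subset:
  fixes u :: "real \<Rightarrow> real"
  assumes "integrable (lebesgue_on S) u" "T \<subseteq> S" "S \<in> sets lebesgue" "T \<in> sets lebesgue"
  shows "integrable (lebesgue_on T) u"
proof -
  have "set_integrable lebesgue S u"
    unfolding set_integrable_def
    by (rule iffD1[OF integrable_restrict_space assms(1)]) (simp add: assms(3))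
  then have "set_integrable lebesgue T u"
    by (rule set_integrable_subset[OF _ assms(4,2)])
  then show ?thesis
    unfolding set_integrable_def
    by (intro iffD2[OF integrable_restrict_space]) (simp_all add: assms(4))
qed

lemma integrable_imp_integrable_on:
  fixes u :: "real \<Rightarrow> real"
  assumes "integrable (lebesgue_on {a<..<b}) u" "a \<le> c" "d \<le> b"
  shows "u integrable_on {c..d}"
proof -
  have "integrable (lebesgue_on {c<..<d}) u"
    by (rule integrable_lebesgue_on_subset[OF assms(1)]) (use assms in auto)
  then have "u integrable_on {c<..<d}"
    by (rule integrable_on_lebesgue_on) simp
  then show ?thesis
    by (simp add: integrable_on_open_interval_real)
qed

lemma integral_lebesgue_on_eq_HK:
  fixes u :: "real \<Rightarrow> real"
  assumes "integrable (lebesgue_on {a<..<b}) u"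
  shows "(LINT x|lebesgue_on {a<..<b}. u x) = integral {a..b} u"
  using assms by (simp add: lebesgue_integral_eq_integral integral_open_interval_real)

lemma primitive_continuous:
  fixes u :: "real \<Rightarrow> real"
  assumes "integrable (lebesgue_on {a<..<b}) u"
  shows "continuous_on {a..b} (\<lambda>x. integral {a..x} u)"
  by (rule indefinite_integral_continuous_1 integrable_imp_integrable_on[OF assms])+ auto

lemma primitive_diff:
  fixes u :: "real \<Rightarrow> real"
  assumes "integrable (lebesgue_on {a<..<b}) u" "a \<le> x" "x \<le> y" "y \<le> b"
  shows "integral {a..y} u - integral {a..x} u = integral {x..y} u"
proof -
  have "integral {a..x} u + integral {x..y} u = integral {a..y} u"
    by (rule Henstock_Kurzweil_Integration.integral_combine)
      (use assms integrable_imp_integrable_on in auto)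
  then show ?thesis by simp
qed

lemma continuous_times_integrable:
  fixes u v :: "real \<Rightarrow> real"
  assumes u: "integrable (lebesgue_on {a<..<b}) u" and v: "continuous_on {a..b} v"
  shows "integrable (lebesgue_on {a<..<b}) (\<lambda>x. v x * u x)"
proof -
  have "bounded (v ` {a..b})"
    by (intro compact_imp_bounded compact_continuous_image v) simp
  then obtain B where B: "\<And>x. x \<in> {a..b} \<Longrightarrow> \<bar>v x\<bar> \<le> B"
    unfolding bounded_iff by fastforce
  have [measurable]: "v \<in> borel_measurable (lebesgue_on {a<..<b})"
    by (rule continuous_imp_measurable_on_sets_lebesgue)
      (auto intro: continuous_on_subset[OF v])
  have [measurable]: "u \<in> borel_measurable (lebesgue_on {a<..<b})"
    using u by simp
  show ?thesis
  proof (rule Bochner_Integration.integrable_bound[where f="\<lambda>x. B * u x"])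
    show "AE x in lebesgue_on {a<..<b}. norm (v x * u x) \<le> norm (B * u x)"
    proof (rule AE_I2)
      fix x assume "x \<in> space (lebesgue_on {a<..<b})"
      then have "\<bar>v x\<bar> \<le> \<bar>B\<bar>" using B[of x] by auto
      then show "norm (v x * u x) \<le> norm (B * u x)"
        by (simp add: abs_mult mult_right_mono)
    qed
  qed (use u in auto)
qed

lemma continuous_imp_integrable_Ioo:
  fixes v :: "real \<Rightarrow> real"
  assumes "continuous_on {a..b} v"
  shows "integrable (lebesgue_on {a<..<b}) v"
proof -
  have "integrable (lebesgue_on {a<..<b}) (\<lambda>x. 1::real)"
    by (metis finite_measure.integrable_const finite_measure_lebesgue_on lmeasurable_interval(2))
  from continuous_times_integrable[OF this assms] show ?thesis by simp
qed

text \<open>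
  Integration by parts for two functions that are merely integrable. The product of the integrals is
  the integral of \<open>u(t) v(x)\<close> over the square; the triangle \<open>t < x\<close> contributes the first term of the
  left-hand side, the triangle \<open>x \<le> t\<close> the second.
\<close>

lemma primitive_product:
  fixes u v :: "real \<Rightarrow> real"
  assumes u: "integrable (lebesgue_on {a<..<b}) u" and v: "integrable (lebesgue_on {a<..<b}) v"
  shows "(LINT x|lebesgue_on {a<..<b}. integral {a..x} u * v x)
       + (LINT x|lebesgue_on {a<..<b}. u x * integral {a..x} v)
       = integral {a..b} u * integral {a..b} v"
proof -
  define M where "M = lebesgue_on {a<..<b}"
  have sp: "space M = {a<..<b}" by (simp add: M_def)
  interpret M: finite_measure M
    unfolding M_def by (rule finite_measure_lebesgue_on) simp
  interpret MM: pair_sigma_finite M M ..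
  have idM: "(\<lambda>x. x) \<in> borel_measurable M"
    unfolding M_def by (rule continuous_imp_measurable_on_sets_lebesgue) (auto intro: continuous_intros)
  have fstsnd: "fst \<in> borel_measurable (M \<Otimes>\<^sub>M M)" "snd \<in> borel_measurable (M \<Otimes>\<^sub>M M)"
    using measurable_compose[OF measurable_fst idM, of M] measurable_compose[OF measurable_snd idM, of M]
    by simp_all
  have [measurable]: "u \<in> borel_measurable M" "v \<in> borel_measurable M"
    using u v by (auto simp: M_def)
  define F where "F = (\<lambda>p. u (fst p) * v (snd p))"
  have F: "integrable (M \<Otimes>\<^sub>M M) F"
  proof (rule MM.Fubini_integrable)
    show "integrable M (\<lambda>x. LINT y|M. norm (F (x, y)))"
      unfolding F_def using u v by (simp add: abs_mult M_def)
    show "AE x in M. integrable M (\<lambda>y. F (x, y))"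
      unfolding F_def using v by (simp add: M_def)
  qed (simp add: F_def)
  have [measurable]: "F \<in> borel_measurable (M \<Otimes>\<^sub>M M)"
    unfolding F_def by measurable
  have F12: "(\<lambda>p. if fst p < snd p then F p else 0) \<in> borel_measurable (M \<Otimes>\<^sub>M M)"
    "(\<lambda>p. if snd p \<le> fst p then F p else 0) \<in> borel_measurable (M \<Otimes>\<^sub>M M)"
    by (intro measurable_If borel_measurable_less borel_measurable_le fstsnd; measurable)+
  define F1 where "F1 = (\<lambda>p. if fst p < snd p then F p else 0)"
  define F2 where "F2 = (\<lambda>p. if snd p \<le> fst p then F p else 0)"
  have F1: "integrable (M \<Otimes>\<^sub>M M) F1"
    by (rule Bochner_Integration.integrable_bound[OF F]) (use F12 in \<open>auto simp: F1_def\<close>)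
  have F2: "integrable (M \<Otimes>\<^sub>M M) F2"
    by (rule Bochner_Integration.integrable_bound[OF F]) (use F12 in \<open>auto simp: F2_def\<close>)
  have prim: "(LINT t|M. (if t < x then w t else 0)) = integral {a..x} w"
    "(LINT t|M. (if t \<le> x then w t else 0)) = integral {a..x} w"
    if w: "integrable M w" and x: "x \<in> {a<..<b}" for w :: "real \<Rightarrow> real" and x
  proof -
    have [measurable]: "w \<in> borel_measurable M" using w by simp
    have wx: "integrable (lebesgue_on {a<..<x}) w"
      by (rule integrable_lebesgue_on_subset[of "{a<..<b}"]) (use w x in \<open>auto simp: M_def\<close>)
    have "(LINT t|M. (if t < x then w t else 0))
        = (LINT t|lebesgue. indicator {a<..<b} t *\<^sub>R (if t < x then w t else 0))"
      unfolding M_def by (subst integral_restrict_space) auto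
    also have "\<dots> = (LINT t|lebesgue. indicator {a<..<x} t *\<^sub>R w t)"
      using x by (intro Bochner_Integration.integral_cong) (auto simp: indicator_def)
    also have "\<dots> = (LINT t|lebesgue_on {a<..<x}. w t)"
      by (subst integral_restrict_space) auto
    also have "\<dots> = integral {a..x} w"
      by (rule integral_lebesgue_on_eq_HK[OF wx])
    finally show 1: "(LINT t|M. (if t < x then w t else 0)) = integral {a..x} w" .
    have "AE t in lebesgue. t \<noteq> x"
      by (rule AE_I'[of "{x}"]) auto
    then have "AE t in M. t \<noteq> x"
      unfolding M_def by (subst AE_restrict_space_iff) auto
    then have "(LINT t|M. (if t \<le> x then w t else 0)) = (LINT t|M. (if t < x then w t else 0))"
    proof (intro integral_cong_AE)
      show "(\<lambda>t. if t \<le> x then w t else 0) \<in> borel_measurable M"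
        "(\<lambda>t. if t < x then w t else 0) \<in> borel_measurable M"
        by (intro measurable_If borel_measurable_less borel_measurable_le idM; measurable)+
      show "AE t in M. (if t \<le> x then w t else 0) = (if t < x then w t else 0)"
        using \<open>AE t in M. t \<noteq> x\<close> by eventually_elim auto
    qed
    with 1 show "(LINT t|M. (if t \<le> x then w t else 0)) = integral {a..x} w" by simp
  qed
  have "(LINT p|(M \<Otimes>\<^sub>M M). F1 p) = (LINT y|M. LINT x|M. F1 (x, y))"
    using MM.integral_snd[of "\<lambda>x y. F1 (x, y)"] F1 by (simp add: split_beta')
  also have "\<dots> = (LINT y|M. integral {a..y} u * v y)"
  proof (rule Bochner_Integration.integral_cong)
    fix y assume "y \<in> space M"
    then have y: "y \<in> {a<..<b}" by (simp add: sp)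
    have "(LINT x|M. F1 (x, y)) = (LINT x|M. (if x < y then u x else 0) * v y)"
      by (intro Bochner_Integration.integral_cong) (auto simp: F1_def F_def)
    also have "\<dots> = integral {a..y} u * v y"
      using prim(1)[of u y] u y by (simp add: M_def)
    finally show "(LINT x|M. F1 (x, y)) = integral {a..y} u * v y" .
  qed simp
  finally have e1: "(LINT p|(M \<Otimes>\<^sub>M M). F1 p) = (LINT y|M. integral {a..y} u * v y)" .
  have "(LINT p|(M \<Otimes>\<^sub>M M). F2 p) = (LINT x|M. LINT y|M. F2 (x, y))"
    using MM.integral_fst'[of F2] F2 by simp
  also have "\<dots> = (LINT x|M. u x * integral {a..x} v)"
  proof (rule Bochner_Integration.integral_cong)
    fix x assume "x \<in> space M"
    then have x: "x \<in> {a<..<b}" by (simp add: sp)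
    have "(LINT y|M. F2 (x, y)) = (LINT y|M. u x * (if y \<le> x then v y else 0))"
      by (intro Bochner_Integration.integral_cong) (auto simp: F2_def F_def)
    also have "\<dots> = u x * integral {a..x} v"
      using prim(2)[of v x] v x by (simp add: M_def)
    finally show "(LINT y|M. F2 (x, y)) = u x * integral {a..x} v" .
  qed simp
  finally have e2: "(LINT p|(M \<Otimes>\<^sub>M M). F2 p) = (LINT x|M. u x * integral {a..x} v)" .
  have "(LINT p|(M \<Otimes>\<^sub>M M). F p) = (LINT x|M. LINT y|M. F (x, y))"
    using MM.integral_fst'[of F] F by simp
  also have "\<dots> = integral {a..b} u * integral {a..b} v"
    unfolding F_def
    using integral_lebesgue_on_eq_HK[OF u] integral_lebesgue_on_eq_HK[OF v] by (simp add: M_def)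
  finally have e: "(LINT p|(M \<Otimes>\<^sub>M M). F p) = integral {a..b} u * integral {a..b} v" .
  have "(LINT p|(M \<Otimes>\<^sub>M M). F p) = (LINT p|(M \<Otimes>\<^sub>M M). F1 p + F2 p)"
    by (intro Bochner_Integration.integral_cong) (auto simp: F1_def F2_def)
  with F1 F2 e e1 e2 show ?thesis
    by (simp add: M_def)
qed

text \<open>
  This recovers a function from its integrals over intervals, and later compares the slopes of two
  primitives that touch. Extending \<open>u\<close> by zero makes it integrable on every bounded interval, as
  \<open>integrable_ccontinuous_explicit\<close> requires.
\<close>

lemma right_Lebesgue_differentiation:
  fixes u :: "real \<Rightarrow> real"
  assumes u: "integrable (lebesgue_on {a<..<b}) u"
  shows "AE x in lebesgue_on {a<..<b}. ((\<lambda>h. integral {x..x + h} u / h) \<longlongrightarrow> u x) (at_right 0)"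
proof -
  define U where "U = (\<lambda>x. if x \<in> {a<..<b} then u x else 0)"
  have "integrable lebesgue (\<lambda>x. indicator {a<..<b} x *\<^sub>R u x)"
    by (rule iffD1[OF integrable_restrict_space u]) simp
  moreover have "(\<lambda>x. indicator {a<..<b} x *\<^sub>R u x) = (\<lambda>x. indicator UNIV x *\<^sub>R U x)"
    by (auto simp: U_def)
  ultimately have "set_integrable lebesgue UNIV U"
    unfolding set_integrable_def by simp
  then have "set_integrable lebesgue (cbox c d) U" for c d
    by (rule set_integrable_subset) auto
  then have "U integrable_on cbox c d" for c d
    using set_lebesgue_integral_eq_integral(1) by blast
  then obtain N where N: "negligible N" and d: "\<And>x e. \<lbrakk>x \<notin> N; 0 < e\<rbrakk> \<Longrightarrow>
       \<exists>d>0. \<forall>h. 0 < h \<and> h < d \<longrightarrow>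
         norm(integral (cbox x (x + h *\<^sub>R One)) U /\<^sub>R h ^ DIM(real) - U x) < e"
    using integrable_ccontinuous_explicit[of U] by blast
  have *: "((\<lambda>h. integral {x..x + h} u / h) \<longlongrightarrow> u x) (at_right 0)" if x: "x \<in> {a<..<b}" "x \<notin> N" for x
  proof (rule tendstoI)
    fix e :: real assume "e > 0"
    from d[OF x(2) this] obtain d where d: "d > 0" "\<And>h. 0 < h \<Longrightarrow> h < d \<Longrightarrow>
         norm(integral {x..x + h} U / h - U x) < e"
      by (auto simp: divide_inverse mult.commute)
    have "dist (integral {x..x + h} u / h) (u x) < e" if h: "0 < h" "h < min d (b - x)" for h
    proof -
      have "integral {x..x + h} U = integral {x..x + h} u"
        by (rule integral_cong) (use x h in \<open>auto simp: U_def\<close>)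
      then show ?thesis
        using d(2)[of h] h x by (simp add: U_def dist_norm)
    qed
    moreover have "min d (b - x) > 0" using d x by auto
    ultimately show "\<forall>\<^sub>F h in at_right 0. dist (integral {x..x + h} u / h) (u x) < e"
      unfolding eventually_at_right_field by blast
  qed
  have "AE x in lebesgue. x \<notin> N"
    using N by (intro AE_not_in) (simp add: negligible_iff_null_sets)
  then show ?thesis
    by (subst AE_restrict_space_iff) (use * in auto)
qed

lemma AE_zero_if_interval_integrals_zero:
  fixes u :: "real \<Rightarrow> real"
  assumes u: "integrable (lebesgue_on {a<..<b}) u"
    and 0: "\<And>c d. a < c \<Longrightarrow> c < d \<Longrightarrow> d < b \<Longrightarrow> integral {c..d} u = 0"
  shows "AE x in lebesgue_on {a<..<b}. u x = 0"
proof -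
  have "u x = 0" if x: "x \<in> {a<..<b}"
    and lim: "((\<lambda>h. integral {x..x + h} u / h) \<longlongrightarrow> u x) (at_right 0)" for x
  proof (rule tendsto_unique[OF _ lim])
    have "\<forall>\<^sub>F h in at_right 0. 0 = integral {x..x + h} u / h"
      unfolding eventually_at_right_field
      by (rule exI[of _ "b - x"]) (use x in \<open>auto simp: 0\<close>)
    then show "((\<lambda>h. integral {x..x + h} u / h) \<longlongrightarrow> 0) (at_right 0)"
      by (rule Lim_transform_eventually[OF tendsto_const])
  qed simp
  with right_Lebesgue_differentiation[OF u] show ?thesis
    by (auto simp: AE_restrict_space_iff elim!: eventually_mono)
qed

lemma integral_eq_if_AE_eq:
  fixes u v :: "real \<Rightarrow> real"
  assumes u: "integrable (lebesgue_on {a<..<b}) u" and v: "integrable (lebesgue_on {a<..<b}) v"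
    and AE: "AE x in lebesgue_on {a<..<b}. u x = v x" and xy: "a \<le> x" "y \<le> b"
  shows "integral {x..y} u = integral {x..y} v"
proof -
  have sub: "{x<..<y} \<subseteq> {a<..<b}" using xy by auto
  have ints: "integrable (lebesgue_on {x<..<y}) u" "integrable (lebesgue_on {x<..<y}) v"
    by (rule integrable_lebesgue_on_subset[of "{a<..<b}"]; use u v sub in simp)+
  have "AE t in lebesgue. t \<in> {x<..<y} \<longrightarrow> u t = v t"
    using AE sub by (auto simp: AE_restrict_space_iff elim!: eventually_mono)
  then have "AE t in lebesgue_on {x<..<y}. u t = v t"
    by (simp add: AE_restrict_space_iff)
  then have "(LINT t|lebesgue_on {x<..<y}. u t) = (LINT t|lebesgue_on {x<..<y}. v t)"
    using ints by (intro integral_cong_AE) auto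
  then show ?thesis
    using ints by (simp only: integral_lebesgue_on_eq_HK)
qed


section \<open>Integration by parts and the du Bois-Reymond lemma\<close>

text \<open>
  The boundary terms are kept, because the components of the noncontact set have endpoints at which
  a test function need not vanish.
\<close>

lemma primitive_integration_by_parts:
  fixes k \<phi> \<phi>' :: "real \<Rightarrow> real"
  assumes ab: "a \<le> b" and k: "integrable (lebesgue_on {a<..<b}) k"
    and deriv: "\<And>x. x \<in> {a..b} \<Longrightarrow> (\<phi> has_real_derivative \<phi>' x) (at x)"
    and cont: "continuous_on {a..b} \<phi>'"
  shows "(LINT x|lebesgue_on {a<..<b}. (c + integral {a..x} k) * \<phi>' x)
       + (LINT x|lebesgue_on {a<..<b}. k x * \<phi> x)
       = (c + integral {a..b} k) * \<phi> b - c * \<phi> a"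
proof -
  note I = continuous_imp_integrable_Ioo continuous_times_integrable primitive_continuous
  have FTC: "integral {a..x} \<phi>' = \<phi> x - \<phi> a" if "x \<in> {a..b}" for x
  proof (rule integral_unique, rule fundamental_theorem_of_calculus)
    fix y assume "y \<in> {a..x}"
    with that show "(\<phi> has_vector_derivative \<phi>' y) (at y within {a..x})"
      using deriv[of y] by (auto simp: has_real_derivative_iff_has_vector_derivative
          intro: has_vector_derivative_at_within)
  qed (use that in auto)
  have cont_\<phi>: "continuous_on {a..b} \<phi>"
    using deriv DERIV_isCont by (intro continuous_at_imp_continuous_on) blast
  have \<phi>': "integrable (lebesgue_on {a<..<b}) \<phi>'"
    by (intro I cont)
  have k\<phi>: "integrable (lebesgue_on {a<..<b}) (\<lambda>x. k x * \<phi> x)"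
    using continuous_times_integrable[OF k cont_\<phi>] by (simp add: mult.commute)
  have Pk: "integrable (lebesgue_on {a<..<b}) (\<lambda>x. integral {a..x} k * \<phi>' x)"
    by (intro I k cont \<phi>')
  have "(LINT x|lebesgue_on {a<..<b}. k x * integral {a..x} \<phi>')
      = (LINT x|lebesgue_on {a<..<b}. k x * \<phi> x - \<phi> a * k x)"
    by (intro Bochner_Integration.integral_cong) (auto simp: FTC algebra_simps)
  also have "\<dots> = (LINT x|lebesgue_on {a<..<b}. k x * \<phi> x) - \<phi> a * integral {a..b} k"
    using k k\<phi> integral_lebesgue_on_eq_HK[OF k] by simp
  finally have 1: "(LINT x|lebesgue_on {a<..<b}. k x * integral {a..x} \<phi>')
    = (LINT x|lebesgue_on {a<..<b}. k x * \<phi> x) - \<phi> a * integral {a..b} k" .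
  have 2: "(LINT x|lebesgue_on {a<..<b}. (c + integral {a..x} k) * \<phi>' x)
      = c * (\<phi> b - \<phi> a) + (LINT x|lebesgue_on {a<..<b}. integral {a..x} k * \<phi>' x)"
    using \<phi>' Pk integral_lebesgue_on_eq_HK[OF \<phi>'] FTC[of b] ab by (simp add: distrib_right)
  show ?thesis
    using primitive_product[OF k \<phi>'] 1 2 FTC[of b] ab by (simp add: algebra_simps)
qed

lemma test_functions_boundary:
  assumes "\<phi> \<in> test_functions {a<..<b}" shows "\<phi> a = 0" "\<phi> b = 0"
  using test_functions_zero_outside[OF assms] by auto

lemma test_function_has_deriv:
  "\<phi> \<in> test_functions S \<Longrightarrow> (\<phi> has_real_derivative deriv \<phi> x) (at x)"
  using smooth_has_deriv test_functions_smooth by blast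

lemma test_function_deriv_continuous:
  "\<phi> \<in> test_functions S \<Longrightarrow> continuous_on T (deriv \<phi>)"
  by (intro continuous_at_imp_continuous_on)
    (use test_functions_smooth smooth_deriv smooth_has_deriv DERIV_isCont in blast)

lemma primitive_weak_parts:
  assumes "\<phi> \<in> test_functions {a<..<b}" "a \<le> b" "integrable (lebesgue_on {a<..<b}) k"
  shows "(LINT x|lebesgue_on {a<..<b}. (c + integral {a..x} k) * deriv \<phi> x)
    = - (LINT x|lebesgue_on {a<..<b}. k x * \<phi> x)"
  using primitive_integration_by_parts[of a b k \<phi> "deriv \<phi>" c] assms
  by (simp add: test_function_has_deriv test_function_deriv_continuous test_functions_boundary)

lemma integrable_times_continuous:
  fixes u v :: "real \<Rightarrow> real"
  assumes "integrable (lebesgue_on {a<..<b}) u" "continuous_on {a..b} v"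
  shows "integrable (lebesgue_on {a<..<b}) (\<lambda>x. u x * v x)"
  using continuous_times_integrable[OF assms] by (simp add: mult.commute)

text \<open>
  Bump functions approximate the indicator function of an interval boundedly, so by dominated
  convergence all integrals over intervals vanish.
\<close>

lemma fundamental_lemma_calculus_of_variations:
  assumes u: "integrable (lebesgue_on {a<..<b}) u"
    and 0: "\<And>\<phi>. \<phi> \<in> test_functions {a<..<b} \<Longrightarrow> (LINT x|lebesgue_on {a<..<b}. u x * \<phi> x) = 0"
  shows "AE x in lebesgue_on {a<..<b}. u x = 0"
proof (rule AE_zero_if_interval_integrals_zero[OF u])
  fix c d assume cd: "a < c" "c < d" "d < b"
  have test: "bump c d (real (Suc n)) \<in> test_functions {a<..<b}" for n
    by (rule test_functions_intro[of _ c d]) (use cd in \<open>auto intro: smooth_bump bump_eq_0\<close>)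
  have int: "integrable (lebesgue_on {a<..<b}) (\<lambda>x. u x * bump c d (real (Suc n)) x)" for n
    by (intro integrable_times_continuous u test_functions_continuous[OF test])
  have "(\<lambda>n. LINT x|lebesgue_on {a<..<b}. u x * bump c d (real (Suc n)) x)
      \<longlonglongrightarrow> (LINT x|lebesgue_on {a<..<b}. u x * indicator {c<..<d} x)"
  proof (rule integral_dominated_convergence)
    show "integrable (lebesgue_on {a<..<b}) (\<lambda>x. \<bar>u x\<bar>)"
      using u by simp
    show "AE x in lebesgue_on {a<..<b}. norm (u x * bump c d (real (Suc n)) x) \<le> \<bar>u x\<bar>" for n
      using bump_bounded[of c d "real (Suc n)"] by (auto simp: abs_mult intro!: mult_left_le)
    show "AE x in lebesgue_on {a<..<b}. (\<lambda>n. u x * bump c d (real (Suc n)) x) \<longlonglongrightarrow> u x * indicator {c<..<d} x"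
      by (intro AE_I2 tendsto_mult tendsto_const bump_tendsto)
    show "(\<lambda>x. u x * indicator {c<..<d} x) \<in> borel_measurable (lebesgue_on {a<..<b})"
      using u by (intro borel_measurable_times borel_measurable_indicator) (use cd in \<open>auto simp: sets_restrict_space_iff\<close>)
  qed (use int in auto)
  then have "(LINT x|lebesgue_on {a<..<b}. u x * indicator {c<..<d} x) = 0"
    using 0[OF test] by (simp add: LIMSEQ_const_iff)
  moreover have "(LINT x|lebesgue_on {a<..<b}. u x * indicator {c<..<d} x)
      = (LINT x|lebesgue_on {c<..<d}. u x)"
  proof -
    have "(\<lambda>x. indicator {a<..<b} x *\<^sub>R (u x * indicator {c<..<d} x)) = (\<lambda>x. indicator {c<..<d} x *\<^sub>R u x)"
      using cd by (auto simp: indicator_def)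
    then show ?thesis by (simp add: integral_restrict_space)
  qed
  moreover have "integrable (lebesgue_on {c<..<d}) u"
    by (rule integrable_lebesgue_on_subset[OF u]) (use cd in auto)
  ultimately show "integral {c..d} u = 0"
    by (simp add: integral_lebesgue_on_eq_HK)
qed

lemma test_function_antiderivative:
  assumes \<phi>: "\<phi> \<in> test_functions {a<..<b}" and ab: "a < b"
    and 0: "(LINT x|lebesgue_on {a<..<b}. \<phi> x) = 0"
  obtains \<omega> where "\<omega> \<in> test_functions {a<..<b}" "deriv \<omega> = \<phi>"
proof -
  obtain c d where cd: "a < c" "c < d" "d < b" "\<And>x. x \<notin> {c..d} \<Longrightarrow> \<phi> x = 0"
    using test_functions_support[OF \<phi> ab] by blast
  define \<omega> where "\<omega> = (\<lambda>x. integral {a..x} \<phi>)"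
  have cont: "continuous_on T \<phi>" for T
    using \<phi> by (rule test_functions_continuous)
  have int: "\<phi> integrable_on {x..y}" for x y
    by (rule integrable_continuous_real) (rule cont)
  have left: "\<omega> x = 0" if "x < c" for x
    unfolding \<omega>_def by (rule integral_unique, rule has_integral_is_0) (use that cd(4) in auto)
  have const: "\<omega> x = \<omega> d" if "x \<ge> d" for x
  proof -
    have "integral {a..d} \<phi> + integral {d..x} \<phi> = integral {a..x} \<phi>"
      by (rule Henstock_Kurzweil_Integration.integral_combine) (use that cd int in auto)
    moreover have "integral {d..x} \<phi> = integral {d..x} (\<lambda>x. 0)"
      by (rule integral_spike[of "{d}"]) (use cd(4) in auto)
    ultimately show ?thesis by (simp add: \<omega>_def)
  qed
  have b: "\<omega> b = 0"
    using 0 integral_lebesgue_on_eq_HK[OF continuous_imp_integrable_Ioo[OF cont]] by (simp add: \<omega>_def)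
  (* To the right of the support the primitive is constant, and its value is the vanishing integral. *)
  have right: "\<omega> x = 0" if "x > d" for x
    using const[of b] const[of x] b that cd(3) by simp
  have deriv: "(\<omega> has_real_derivative \<phi> x) (at x)" for x
  proof (cases "x < c")
    case True
    have "((\<lambda>x. 0) has_real_derivative 0) (at x)" by simp
    then have "(\<omega> has_real_derivative 0) (at x)"
      by (rule has_field_derivative_transform_within_open[where S="{..<c}"]) (use True left in auto)
    with True cd show ?thesis by simp
  next
    case False
    have "(\<omega> has_real_derivative \<phi> x) (at x within {a..x+1})"
      unfolding \<omega>_def by (rule integral_has_real_derivative[OF cont]) (use False cd in auto)
    moreover have "at x within {a..x+1} = at x"
      by (rule at_within_interior) (use False cd in auto)
    ultimately show ?thesis by simp
  qed
  show thesis
  proof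
    show "\<omega> \<in> test_functions {a<..<b}"
    proof (rule test_functions_intro)
      show "smooth \<omega>" using smooth_if_deriv_smooth[OF test_functions_smooth[OF \<phi>] deriv] .
      show "{c..d} \<subseteq> {a<..<b}" using cd by auto
    qed (use left right in force)
    show "deriv \<omega> = \<phi>" using deriv DERIV_imp_deriv by blast
  qed
qed

lemma test_functions_lincomb:
  assumes "\<phi> \<in> test_functions {a<..<b}" "\<theta> \<in> test_functions {a<..<b}" "a < b"
  shows "(\<lambda>x. p * \<phi> x + q * \<theta> x) \<in> test_functions {a<..<b}"
proof -
  obtain c d where cd: "a < c" "c < d" "d < b" "\<And>x. x \<notin> {c..d} \<Longrightarrow> \<phi> x = 0"
    using test_functions_support[OF assms(1,3)] by blast
  obtain c' d' where cd': "a < c'" "c' < d'" "d' < b" "\<And>x. x \<notin> {c'..d'} \<Longrightarrow> \<theta> x = 0"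
    using test_functions_support[OF assms(2,3)] by blast
  show ?thesis
  proof (rule test_functions_intro)
    show "smooth (\<lambda>x. p * \<phi> x + q * \<theta> x)"
      using assms by (intro smooth_lincomb test_functions_smooth)
    show "{min c c'..max d d'} \<subseteq> {a<..<b}" using cd cd' by auto
    fix x assume "x \<notin> {min c c'..max d d'}"
    then have "x \<notin> {c..d}" "x \<notin> {c'..d'}" by auto
    then show "p * \<phi> x + q * \<theta> x = 0" using cd(4) cd'(4) by simp
  qed
qed

text \<open>
  A test function with integral zero is the derivative of a test function. Subtracting from \<open>\<phi>\<close> a
  multiple of a fixed \<open>\<theta>\<close> with nonzero integral \<open>m\<close> gives such a function, which yields the constant
  \<open>c\<close> as the integral of \<open>u \<theta>\<close> divided by \<open>m\<close>.
\<close>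

lemma du_Bois_Reymond:
  assumes ab: "a < b" and u: "integrable (lebesgue_on {a<..<b}) u"
    and 0: "\<And>\<phi>. \<phi> \<in> test_functions {a<..<b} \<Longrightarrow> (LINT x|lebesgue_on {a<..<b}. u x * deriv \<phi> x) = 0"
  obtains c where "AE x in lebesgue_on {a<..<b}. u x = c"
proof -
  let ?M = "lebesgue_on {a<..<b}"
  (* Any two points of the interval would do. *)
  define p q where "p = a + (b - a) / 3" and "q = a + 2 * (b - a) / 3"
  have pq: "a < p" "p < q" "q < b" using ab by (auto simp: p_def q_def field_simps)
  define \<theta> where "\<theta> = bump p q 1"
  have \<theta>: "\<theta> \<in> test_functions {a<..<b}"
    unfolding \<theta>_def
    by (rule test_functions_intro[of _ p q]) (use pq in \<open>auto intro: smooth_bump bump_eq_0\<close>)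
  have contI: "integrable ?M \<phi>" "integrable ?M (\<lambda>x. u x * \<phi> x)" if "\<phi> \<in> test_functions {a<..<b}" for \<phi>
    using test_functions_continuous[OF that] u
    by (auto intro: continuous_imp_integrable_Ioo integrable_times_continuous)
  define m where "m = (LINT x|?M. \<theta> x)"
  have "m \<noteq> 0"
  proof
    assume "m = 0"
    then have "AE x in ?M. \<theta> x = 0"
      using integral_nonneg_eq_0_iff_AE[of ?M \<theta>] contI(1)[OF \<theta>] bump_bounded(1)
      by (auto simp: m_def \<theta>_def)
    then have "AE x in lebesgue. x \<in> {a<..<b} \<longrightarrow> \<theta> x = 0"
      by (simp add: AE_restrict_space_iff)
    then have "AE x in lebesgue. x \<notin> {p<..<q}"
    proof eventually_elim
      case (elim x)
      then show ?case
        using bump_pos[of 1 x p q] pq by (fastforce simp: \<theta>_def)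
    qed
    then have "{p<..<q} \<in> null_sets lebesgue"
      by (simp add: AE_iff_null_sets)
    then show False using pq by (simp add: null_sets_def)
  qed
  define c where "c = (LINT x|?M. u x * \<theta> x) / m"
  have "AE x in ?M. u x - c = 0"
  proof (rule fundamental_lemma_calculus_of_variations)
    show "integrable ?M (\<lambda>x. u x - c)"
      using u continuous_imp_integrable_Ioo[of a b "\<lambda>x. c"] by simp
    fix \<phi> assume \<phi>: "\<phi> \<in> test_functions {a<..<b}"
    define r where "r = (LINT x|?M. \<phi> x) / m"
    have "(\<lambda>x. 1 * \<phi> x + (- r) * \<theta> x) \<in> test_functions {a<..<b}"
      by (rule test_functions_lincomb[OF \<phi> \<theta> ab])
    moreover have "(LINT x|?M. 1 * \<phi> x + (- r) * \<theta> x) = 0"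
      using contI(1)[OF \<phi>] contI(1)[OF \<theta>] \<open>m \<noteq> 0\<close> by (simp add: r_def m_def)
    ultimately obtain \<omega> where "\<omega> \<in> test_functions {a<..<b}" "deriv \<omega> = (\<lambda>x. 1 * \<phi> x + (- r) * \<theta> x)"
      using test_function_antiderivative[OF _ ab] by blast
    with 0[of \<omega>] have "(LINT x|?M. u x * \<phi> x - r * (u x * \<theta> x)) = 0"
      by (simp add: algebra_simps)
    then have "(LINT x|?M. u x * \<phi> x) = r * (c * m)"
      using contI(2)[OF \<phi>] contI(2)[OF \<theta>] \<open>m \<noteq> 0\<close> by (simp add: c_def)
    also have "\<dots> = c * (LINT x|?M. \<phi> x)"
      using \<open>m \<noteq> 0\<close> by (simp add: r_def)
    finally show "(LINT x|?M. (u x - c) * \<phi> x) = 0"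
      using contI[OF \<phi>] by (simp add: left_diff_distrib)
  qed
  then show thesis by (intro that[of c]) auto
qed

section \<open>Components of open sets of real numbers\<close>

text \<open>
  Were an endpoint of a component a point of the open set, adjoining it would give a larger
  connected subset.
\<close>

lemma component_of_bounded_open_real:
  fixes U :: "real set"
  assumes U: "open U" "bounded U" and C: "C \<in> components U"
  obtains \<alpha> \<beta> where "\<alpha> < \<beta>" "C = {\<alpha><..<\<beta>}" "\<alpha> \<notin> U" "\<beta> \<notin> U"
proof -
  have "open C" "C \<noteq> {}" "C \<subseteq> U" "connected C"
    using C U open_components in_components_nonempty in_components_subset in_components_connected by blast+
  then have bdd: "bdd_below C" "bdd_above C"
    using bounded_subset[OF U(2) \<open>C \<subseteq> U\<close>] by (auto intro: bounded_imp_bdd_below bounded_imp_bdd_above)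
  define \<alpha> \<beta> where "\<alpha> = Inf C" and "\<beta> = Sup C"
  have in_C: "\<alpha> < x \<and> x < \<beta>" if x: "x \<in> C" for x
  proof -
    obtain e where e: "e > 0" "\<And>y. \<bar>y - x\<bar> < e \<Longrightarrow> y \<in> C"
      using \<open>open C\<close> x by (auto simp: open_real)
    have "x - e/2 \<in> C" "x + e/2 \<in> C" using e by auto
    then have "\<alpha> \<le> x - e/2" "x + e/2 \<le> \<beta>"
      using bdd by (auto simp: \<alpha>_def \<beta>_def intro: cInf_lower cSup_upper)
    with e show ?thesis by simp
  qed
  have C_eq: "C = {\<alpha><..<\<beta>}"
  proof safe
    fix x assume x: "x \<in> {\<alpha><..<\<beta>}"
    obtain y where "y \<in> C" "y < x"
      using x cInf_lessD[OF \<open>C \<noteq> {}\<close>, of x] by (auto simp: \<alpha>_def)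
    moreover obtain z where "z \<in> C" "x < z"
      using x less_cSupD[OF \<open>C \<noteq> {}\<close>, of x] by (auto simp: \<beta>_def)
    ultimately show "x \<in> C"
      using \<open>connected C\<close> by (meson connectedD_interval less_imp_le)
  qed (use in_C in auto)
  have \<alpha>\<beta>: "\<alpha> < \<beta>" using \<open>C \<noteq> {}\<close> C_eq by auto
  have max: "T \<subseteq> C" if "connected T" "T \<subseteq> U" "C \<inter> T \<noteq> {}" for T
    using components_maximal[OF C that] .
  have ne: "(\<alpha> + \<beta>) / 2 \<in> C" using C_eq \<alpha>\<beta> by auto
  have "\<alpha> \<notin> U"
  proof
    assume "\<alpha> \<in> U"
    moreover have "{\<alpha>..<\<beta>} = insert \<alpha> C" using C_eq \<alpha>\<beta> by auto
    moreover have "connected {\<alpha>..<\<beta>}" by simp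
    ultimately have "insert \<alpha> C \<subseteq> C"
      using max[of "insert \<alpha> C"] \<open>C \<subseteq> U\<close> ne by auto
    with C_eq show False by auto
  qed
  moreover have "\<beta> \<notin> U"
  proof
    assume "\<beta> \<in> U"
    moreover have "{\<alpha><..\<beta>} = insert \<beta> C" using C_eq \<alpha>\<beta> by auto
    moreover have "connected {\<alpha><..\<beta>}" by simp
    ultimately have "insert \<beta> C \<subseteq> C"
      using max[of "insert \<beta> C"] \<open>C \<subseteq> U\<close> ne by auto
    with C_eq show False by auto
  qed
  ultimately show thesis using that \<alpha>\<beta> C_eq by blast
qed

text \<open>
  Countable additivity. The disjoint sequence of sets lists the components by their number in an
  enumeration and is empty at the numbers that are not used.
\<close>

lemma integral_zero_if_zero_on_components:
  fixes f :: "real \<Rightarrow> real"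
  assumes U: "open U" and f: "set_integrable lebesgue U f"
    and 0: "\<And>C. C \<in> components U \<Longrightarrow> (LINT x:C|lebesgue. f x) = 0"
  shows "(LINT x:U|lebesgue. f x) = 0"
proof -
  have op: "open C" if "C \<in> components U" for C
    using open_components[OF U that] .
  have "countable (components U)"
    using countable_disjoint_open_subsets[of "components U"] op pairwise_disjoint_components[of U]
    by (simp add: disjnt_def disjoint_def pairwise_def)
  then have inj: "inj_on (to_nat_on (components U)) (components U)"
    by (rule inj_on_to_nat_on)
  define A where "A = (\<lambda>i. \<Union>{C \<in> components U. to_nat_on (components U) C = i})"
  have A_cases: "A i = {} \<or> A i \<in> components U" for i
  proof (cases "\<exists>C\<in>components U. to_nat_on (components U) C = i")
    case True
    then obtain C where C: "C \<in> components U" "to_nat_on (components U) C = i" by blast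
    then have "{C \<in> components U. to_nat_on (components U) C = i} = {C}"
      using inj by (auto simp: inj_on_def)
    with C show ?thesis by (simp add: A_def)
  next
    case False
    then have "{C \<in> components U. to_nat_on (components U) C = i} = {}" by blast
    then have "A i = {}" unfolding A_def by (simp only: Union_empty)
    then show ?thesis ..
  qed
  have UA: "(\<Union>i. A i) = U"
    unfolding A_def using Union_components[of U] by blast
  have "(LINT x:(\<Union>i. A i)|lebesgue. f x) = (\<Sum>i. (LINT x:(A i)|lebesgue. f x))"
  proof (rule lebesgue_integral_countable_add)
    show "A i \<in> sets lebesgue" for i
      using A_cases[of i] op by auto
    show "A i \<inter> A j = {}" if "i \<noteq> j" for i j
    proof (rule ccontr)
      assume "A i \<inter> A j \<noteq> {}"
      then obtain x C D where x: "x \<in> C" "x \<in> D" "C \<in> components U" "D \<in> components U"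
        "to_nat_on (components U) C = i" "to_nat_on (components U) D = j"
        by (auto simp: A_def)
      then have "C = D" using pairwise_disjoint_components[of U] by (auto simp: pairwise_def)
      with x that show False by simp
    qed
    show "set_integrable lebesgue (\<Union>i. A i) f" using f UA by simp
  qed
  moreover have "(LINT x:(A i)|lebesgue. f x) = 0" for i
    using A_cases[of i] 0 by (auto simp: set_lebesgue_integral_def)
  ultimately show ?thesis by (simp add: UA)
qed

section \<open>Convex functions touching a barrier from below\<close>

text \<open>
  This is the slope of the chord, from \<open>p\<close> to \<open>q\<close>, of a primitive of \<open>u\<close>. Monotonicity of the means
  over adjacent intervals is convexity of the primitive; working with means avoids derivatives of
  the primitive altogether.
\<close>

definition mean :: "(real \<Rightarrow> real) \<Rightarrow> real \<Rightarrow> real \<Rightarrow> real" where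
  "mean u p q = integral {p..q} u / (q - p)"

lemma mean_tendsto_right:
  assumes h: "continuous_on {a..b} h" and c: "a \<le> c" "c < b"
  shows "((\<lambda>t. mean h c (c + t)) \<longlongrightarrow> h c) (at_right 0)"
proof -
  have "((\<lambda>x. integral {c..x} h) has_real_derivative h c) (at c within {c..b})"
    by (rule integral_has_real_derivative) (use c in \<open>auto intro: continuous_on_subset[OF h]\<close>)
  moreover have "at c within {c..b} = at_right c"
    using c by (simp add: at_within_Icc_at_right)
  ultimately have "((\<lambda>x. integral {c..x} h / (x - c)) \<longlongrightarrow> h c) (at_right c)"
    by (simp add: has_field_derivative_iff)
  then show ?thesis
    by (simp add: mean_def filterlim_at_right_to_0[of _ _ c] add.commute)
qed

lemma mean_tendsto_left:
  assumes h: "continuous_on {a..b} h" and c: "a < c" "c \<le> b"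
  shows "((\<lambda>t. mean h (c - t) c) \<longlongrightarrow> h c) (at_right 0)"
proof -
  have "((\<lambda>x. integral {a..x} h) has_real_derivative h c) (at c within {a..c})"
    by (rule integral_has_real_derivative) (use c in \<open>auto intro: continuous_on_subset[OF h]\<close>)
  moreover have "at c within {a..c} = at_left c"
    using c by (simp add: at_within_Icc_at_left)
  ultimately have "((\<lambda>x. (integral {a..x} h - integral {a..c} h) / (x - c)) \<longlongrightarrow> h c) (at_left c)"
    by (simp add: has_field_derivative_iff)
  then have "((\<lambda>t. (integral {a..c - t} h - integral {a..c} h) / (- t)) \<longlongrightarrow> h c) (at_right 0)"
    by (simp add: filterlim_at_left_to_right filterlim_at_right_to_0[of _ _ "-c"] add.commute algebra_simps)
  then show ?thesis
  proof (rule Lim_transform_eventually)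
    have "(integral {a..c - t} h - integral {a..c} h) / (- t) = mean h (c - t) c" if "0 < t" "t < c - a" for t
    proof -
      have "integral {a..c - t} h + integral {c - t..c} h = integral {a..c} h"
        by (rule Henstock_Kurzweil_Integration.integral_combine)
          (use that c in \<open>auto intro!: integrable_continuous_real continuous_on_subset[OF h]\<close>)
      then have "integral {a..c - t} h - integral {a..c} h = - integral {c - t..c} h" by linarith
      then show ?thesis by (simp add: mean_def)
    qed
    then show "\<forall>\<^sub>F t in at_right 0. (integral {a..c - t} h - integral {a..c} h) / (- t) = mean h (c - t) c"
      unfolding eventually_at_right_field using c by (intro exI[of _ "c - a"]) auto
  qed
qed

text \<open>
  Two chords are compared with a third one, which lies to the right of both.
\<close>

lemma mean_combine_const:
  fixes g :: "real \<Rightarrow> real"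
  assumes eq: "\<And>p q r. \<alpha> < p \<Longrightarrow> p < q \<Longrightarrow> q < r \<Longrightarrow> r < \<beta> \<Longrightarrow> mean g p q = mean g q r"
  obtains s where "\<And>p q. \<alpha> < p \<Longrightarrow> p < q \<Longrightarrow> q < \<beta> \<Longrightarrow> mean g p q = s"
proof -
  have "mean g p q = mean g p' q'" if "\<alpha> < p" "p < q" "q < \<beta>" "\<alpha> < p'" "p' < q'" "q' < \<beta>" for p q p' q'
  proof -
    define m where "m = max q q'"
    have m: "m < \<beta>" using that by (simp add: m_def)
    define r where "r = (m + \<beta>) / 2"
    have r: "m < r" "r < \<beta>" using m by (auto simp: r_def)
    have *: "mean g p q = mean g m r" if "\<alpha> < p" "p < q" "q \<le> m" for p q
    proof (cases "q = m")
      case True then show ?thesis using that r eq by simp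
    next
      case False
      then have "mean g p q = mean g q m" "mean g q m = mean g m r"
        using that r m by (auto intro!: eq)
      then show ?thesis by simp
    qed
    show ?thesis using *[of p q] *[of p' q'] that by (simp add: m_def)
  qed
  then show thesis
    using that by (metis dense order_less_trans)
qed

text \<open>
  Let \<open>\<Gamma>\<close> and \<open>H\<close> be primitives of \<open>g\<close> and \<open>h\<close>; then \<open>\<Gamma> - H\<close> is \<open>w\<close> up to a constant and has a maximum at
  \<open>c\<close>. Chords of \<open>\<Gamma>\<close> to the right of \<open>c\<close> are therefore at most as steep as those of \<open>H\<close>, to the left at
  least as steep. By convexity a right chord of \<open>\<Gamma>\<close> is at least as steep as every left chord, hence as
  the left chords of \<open>H\<close>, whose slopes tend to \<open>h c\<close>; and symmetrically.
\<close>

lemma contact_mean_bounds: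
  fixes g h w :: "real \<Rightarrow> real"
  assumes h: "continuous_on {a..b} h"
    and incr: "\<And>x y. a \<le> x \<Longrightarrow> x \<le> y \<Longrightarrow> y \<le> b \<Longrightarrow> w y - w x = integral {x..y} g - integral {x..y} h"
    and nonpos: "\<And>x. a < x \<Longrightarrow> x < b \<Longrightarrow> w x \<le> 0"
    and convex: "\<And>p q r. a < p \<Longrightarrow> p < q \<Longrightarrow> q < r \<Longrightarrow> r < b \<Longrightarrow> mean g p q \<le> mean g q r"
    and c: "a < c" "c < b" "w c = 0"
  shows contact_mean_right: "c < r \<Longrightarrow> r < b \<Longrightarrow> h c \<le> mean g c r \<and> mean g c r \<le> mean h c r"
    and contact_mean_left: "a < p \<Longrightarrow> p < c \<Longrightarrow> mean h p c \<le> mean g p c \<and> mean g p c \<le> h c"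
proof -
  have right: "mean g c r \<le> mean h c r" if "c < r" "r < b" for r
    using incr[of c r] nonpos[of r] that c by (auto simp: mean_def intro!: divide_right_mono)
  have left: "mean h p c \<le> mean g p c" if "a < p" "p < c" for p
    using incr[of p c] nonpos[of p] that c by (auto simp: mean_def intro!: divide_right_mono)
  show "h c \<le> mean g c r \<and> mean g c r \<le> mean h c r" if r: "c < r" "r < b"
  proof
    show "h c \<le> mean g c r"
    proof (rule tendsto_upperbound)
      show "((\<lambda>t. mean h (c - t) c) \<longlongrightarrow> h c) (at_right 0)"
        by (rule mean_tendsto_left[OF h]) (use c in auto)
      show "\<forall>\<^sub>F t in at_right 0. mean h (c - t) c \<le> mean g c r"
        unfolding eventually_at_right_field
      proof (intro exI conjI allI impI)
        show "0 < c - a" using c by simp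
        fix t assume "0 < t" "t < c - a"
        then show "mean h (c - t) c \<le> mean g c r"
          using left[of "c - t"] convex[of "c - t" c r] r by linarith
      qed
    qed simp
  qed (rule right[OF that])
  show "mean h p c \<le> mean g p c \<and> mean g p c \<le> h c" if p: "a < p" "p < c"
  proof
    show "mean g p c \<le> h c"
    proof (rule tendsto_lowerbound)
      show "((\<lambda>t. mean h c (c + t)) \<longlongrightarrow> h c) (at_right 0)"
        by (rule mean_tendsto_right[OF h]) (use c in auto)
      show "\<forall>\<^sub>F t in at_right 0. mean g p c \<le> mean h c (c + t)"
        unfolding eventually_at_right_field
      proof (intro exI conjI allI impI)
        show "0 < b - c" using c by simp
        fix t assume "0 < t" "t < b - c"
        then show "mean g p c \<le> mean h c (c + t)"
          using right[of "c + t"] convex[of p c "c + t"] p by linarith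
      qed
    qed simp
  qed (rule left[OF that])
qed

lemma AE_constant_if_means_equal:
  fixes g :: "real \<Rightarrow> real"
  assumes \<alpha>\<beta>: "\<alpha> < \<beta>" and g: "integrable (lebesgue_on {\<alpha><..<\<beta>}) g"
    and eq: "\<And>p q r. \<alpha> < p \<Longrightarrow> p < q \<Longrightarrow> q < r \<Longrightarrow> r < \<beta> \<Longrightarrow> mean g p q = mean g q r"
  obtains s where "AE x in lebesgue_on {\<alpha><..<\<beta>}. g x = s"
    "\<And>p q. \<alpha> \<le> p \<Longrightarrow> p < q \<Longrightarrow> q \<le> \<beta> \<Longrightarrow> mean g p q = s"
proof -
  obtain s where s: "\<And>p q. \<alpha> < p \<Longrightarrow> p < q \<Longrightarrow> q < \<beta> \<Longrightarrow> mean g p q = s"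
    using mean_combine_const[OF eq] by blast
  have "AE x in lebesgue_on {\<alpha><..<\<beta>}. g x - s = 0"
  proof (rule AE_zero_if_interval_integrals_zero)
    show "integrable (lebesgue_on {\<alpha><..<\<beta>}) (\<lambda>x. g x - s)"
      using g continuous_imp_integrable_Ioo[of \<alpha> \<beta> "\<lambda>x. s"] by simp
    fix p q assume pq: "\<alpha> < p" "p < q" "q < \<beta>"
    have "g integrable_on {p..q}"
      by (rule integrable_imp_integrable_on[OF g]) (use pq in auto)
    then have "integral {p..q} (\<lambda>x. g x - s) = integral {p..q} g - integral {p..q} (\<lambda>x. s)"
      by (rule Henstock_Kurzweil_Integration.integral_diff) auto
    also have "\<dots> = 0"
      using s[OF pq] pq by (simp add: mean_def field_simps)
    finally show "integral {p..q} (\<lambda>x. g x - s) = 0" .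
  qed
  then have AE: "AE x in lebesgue_on {\<alpha><..<\<beta>}. g x = s" by simp
  have "mean g p q = s" if pq: "\<alpha> \<le> p" "p < q" "q \<le> \<beta>" for p q
  proof -
    have "integral {p..q} g = integral {p..q} (\<lambda>x. s)"
      by (rule integral_eq_if_AE_eq[OF g _ AE])
        (use pq in \<open>auto intro: continuous_imp_integrable_Ioo\<close>)
    then show ?thesis using pq by (simp add: mean_def)
  qed
  with AE show thesis by (rule that)
qed

text \<open>
  If a primitive of \<open>g\<close> is affine next to a contact point, on either side, then the bounds on the
  means of \<open>g\<close> determine its slope there.
\<close>

lemma contact_slope_agrees:
  fixes g h w :: "real \<Rightarrow> real"
  assumes h: "continuous_on {a..b} h"
    and incr: "\<And>x y. a \<le> x \<Longrightarrow> x \<le> y \<Longrightarrow> y \<le> b \<Longrightarrow> w y - w x = integral {x..y} g - integral {x..y} h"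
    and nonpos: "\<And>x. a < x \<Longrightarrow> x < b \<Longrightarrow> w x \<le> 0"
    and convex: "\<And>p q r. a < p \<Longrightarrow> p < q \<Longrightarrow> q < r \<Longrightarrow> r < b \<Longrightarrow> mean g p q \<le> mean g q r"
    and c: "a < c" "c < b" "w c = 0"
  shows "c < \<beta> \<Longrightarrow> \<beta> \<le> b \<Longrightarrow> (\<And>q. c < q \<Longrightarrow> q < \<beta> \<Longrightarrow> mean g c q = s) \<Longrightarrow> h c = s"
    and "\<alpha> < c \<Longrightarrow> a \<le> \<alpha> \<Longrightarrow> (\<And>p. \<alpha> < p \<Longrightarrow> p < c \<Longrightarrow> mean g p c = s) \<Longrightarrow> h c = s"
proof -
  note R = contact_mean_right[OF h incr nonpos convex c] and L = contact_mean_left[OF h incr nonpos convex c]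
  show "h c = s" if \<beta>: "c < \<beta>" "\<beta> \<le> b" and s: "\<And>q. c < q \<Longrightarrow> q < \<beta> \<Longrightarrow> mean g c q = s"
  proof (rule antisym)
    show "h c \<le> s"
      using R[of "(c + \<beta>) / 2"] s[of "(c + \<beta>) / 2"] \<beta> by auto
    show "s \<le> h c"
    proof (rule tendsto_lowerbound)
      show "((\<lambda>t. mean h c (c + t)) \<longlongrightarrow> h c) (at_right 0)"
        by (rule mean_tendsto_right[OF h]) (use c in auto)
      show "\<forall>\<^sub>F t in at_right 0. s \<le> mean h c (c + t)"
        unfolding eventually_at_right_field
      proof (intro exI conjI allI impI)
        show "0 < \<beta> - c" using \<beta> by simp
        fix t assume "0 < t" "t < \<beta> - c"
        then show "s \<le> mean h c (c + t)"
          using R[of "c + t"] s[of "c + t"] \<beta> by auto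
      qed
    qed simp
  qed
  show "h c = s" if \<alpha>: "\<alpha> < c" "a \<le> \<alpha>" and s: "\<And>p. \<alpha> < p \<Longrightarrow> p < c \<Longrightarrow> mean g p c = s"
  proof (rule antisym)
    show "s \<le> h c"
      using L[of "(\<alpha> + c) / 2"] s[of "(\<alpha> + c) / 2"] \<alpha> by auto
    show "h c \<le> s"
    proof (rule tendsto_upperbound)
      show "((\<lambda>t. mean h (c - t) c) \<longlongrightarrow> h c) (at_right 0)"
        by (rule mean_tendsto_left[OF h]) (use c in auto)
      show "\<forall>\<^sub>F t in at_right 0. mean h (c - t) c \<le> s"
        unfolding eventually_at_right_field
      proof (intro exI conjI allI impI)
        show "0 < c - \<alpha>" using \<alpha> by simp
        fix t assume "0 < t" "t < c - \<alpha>"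
        then show "mean h (c - t) c \<le> s"
          using L[of "c - t"] s[of "c - t"] \<alpha> by auto
      qed
    qed simp
  qed
qed

text \<open>
  At a contact point the means of \<open>g\<close> over short intervals to the right are squeezed between \<open>h c\<close>
  and the means of \<open>h\<close>; almost everywhere they also tend to \<open>g c\<close>.
\<close>

lemma AE_equal_on_contact_set:
  fixes g h w :: "real \<Rightarrow> real"
  assumes h: "continuous_on {a..b} h" and g: "integrable (lebesgue_on {a<..<b}) g"
    and incr: "\<And>x y. a \<le> x \<Longrightarrow> x \<le> y \<Longrightarrow> y \<le> b \<Longrightarrow> w y - w x = integral {x..y} g - integral {x..y} h"
    and nonpos: "\<And>x. a < x \<Longrightarrow> x < b \<Longrightarrow> w x \<le> 0"
    and convex: "\<And>p q r. a < p \<Longrightarrow> p < q \<Longrightarrow> q < r \<Longrightarrow> r < b \<Longrightarrow> mean g p q \<le> mean g q r"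
  shows "AE x in lebesgue_on {a<..<b}. w x = 0 \<longrightarrow> g x = h x"
proof -
  have "g c = h c" if c: "a < c" "c < b" "w c = 0"
    and lim: "((\<lambda>t. integral {c..c + t} g / t) \<longlongrightarrow> g c) (at_right 0)" for c
  proof (rule tendsto_unique[OF _ lim])
    note R = contact_mean_right[OF h incr nonpos convex c]
    show "((\<lambda>t. integral {c..c + t} g / t) \<longlongrightarrow> h c) (at_right 0)"
    proof (rule tendsto_sandwich[OF _ _ tendsto_const mean_tendsto_right[OF h]])
      have ev: "\<forall>\<^sub>F t in at_right 0. 0 < t \<and> t < b - c"
        unfolding eventually_at_right_field using c by (intro exI[of _ "b - c"]) auto
      show "\<forall>\<^sub>F t in at_right 0. h c \<le> integral {c..c + t} g / t"
        using ev
      proof eventually_elim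
        case (elim t)
        then show ?case using R[of "c + t"] by (simp add: mean_def)
      qed
      show "\<forall>\<^sub>F t in at_right 0. integral {c..c + t} g / t \<le> mean h c (c + t)"
        using ev
      proof eventually_elim
        case (elim t)
        then show ?case using R[of "c + t"] by (simp add: mean_def)
      qed
    qed (use c in auto)
  qed simp
  with right_Lebesgue_differentiation[OF g] show ?thesis
    by (auto simp: AE_restrict_space_iff elim!: eventually_mono)
qed

lemma open_negativity_set:
  fixes w :: "real \<Rightarrow> real"
  assumes "continuous_on {a..b} w"
  shows "open {x \<in> {a<..<b}. w x < 0}"
proof -
  have "open ({a<..<b} \<inter> w -` {..<0})"
    by (rule continuous_open_preimage) (auto intro: continuous_on_subset[OF assms])
  moreover have "{a<..<b} \<inter> w -` {..<0} = {x \<in> {a<..<b}. w x < 0}" by auto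
  ultimately show ?thesis by simp
qed

text \<open>
  The regularity statement in terms of real functions: \<open>g\<close> has the weak derivative \<open>k\<close> on the contact
  set and \<open>0\<close> on the noncontact set \<open>U\<close>. The function \<open>F = (h - g) \<phi>' + k \<phi>\<close> integrates to zero over
  each component of \<open>U\<close>: there \<open>g\<close> is a constant \<open>s\<close>, so \<open>F\<close> is almost everywhere the
  derivative of \<open>(h - s) \<phi>\<close>, and at each endpoint either \<open>h = s\<close> (a contact point) or \<open>\<phi> = 0\<close> (an endpoint of the interval).
\<close>

lemma obstacle_weak_derivative:
  fixes g k w :: "real \<Rightarrow> real" and a b h0 :: real
  defines "h \<equiv> \<lambda>x. h0 + integral {a..x} k"
  defines "U \<equiv> {x \<in> {a<..<b}. w x < 0}"
  assumes ab: "a < b" and g: "integrable (lebesgue_on {a<..<b}) g" and k: "integrable (lebesgue_on {a<..<b}) k"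
    and incr: "\<And>x y. a \<le> x \<Longrightarrow> x \<le> y \<Longrightarrow> y \<le> b \<Longrightarrow> w y - w x = integral {x..y} g - integral {x..y} h"
    and nonpos: "\<And>x. a < x \<Longrightarrow> x < b \<Longrightarrow> w x \<le> 0"
    and convex: "\<And>p q r. a < p \<Longrightarrow> p < q \<Longrightarrow> q < r \<Longrightarrow> r < b \<Longrightarrow> mean g p q \<le> mean g q r"
    and affine: "\<And>p q r. a < p \<Longrightarrow> p < q \<Longrightarrow> q < r \<Longrightarrow> r < b \<Longrightarrow> \<forall>x\<in>{p..r}. w x < 0 \<Longrightarrow>
        mean g q r \<le> mean g p q"
    and \<phi>: "\<phi> \<in> test_functions {a<..<b}"
  shows "(LINT x|lebesgue_on {a<..<b}. g x * deriv \<phi> x)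
      = - (LINT x|lebesgue_on {a<..<b}. (indicator (- U) x * k x) * \<phi> x)"
proof -
  let ?M = "lebesgue_on {a<..<b}"
  have h: "continuous_on {a..b} h"
    unfolding h_def by (intro continuous_intros primitive_continuous k)
  have contw: "continuous_on {a..b} w"
  proof (rule continuous_on_eq)
    show "continuous_on {a..b} (\<lambda>x. w a + (integral {a..x} g - integral {a..x} h))"
      by (intro continuous_intros primitive_continuous g continuous_imp_integrable_Ioo h)
    show "w a + (integral {a..x} g - integral {a..x} h) = w x" if "x \<in> {a..b}" for x
      using incr[of a x] that by auto
  qed
  have "open U"
    unfolding U_def by (rule open_negativity_set[OF contw])
  then have U_sets [measurable]: "U \<in> sets lebesgue" by auto
  have U_sub: "U \<subseteq> {a<..<b}" by (auto simp: U_def)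
  note \<phi>_cont = test_functions_continuous[OF \<phi>, of "{a..b}"] test_function_deriv_continuous[OF \<phi>, of "{a..b}"]
  have hI: "integrable ?M h" by (rule continuous_imp_integrable_Ioo[OF h])
  have ints: "integrable ?M (\<lambda>x. g x * deriv \<phi> x)" "integrable ?M (\<lambda>x. h x * deriv \<phi> x)" "integrable ?M (\<lambda>x. k x * \<phi> x)"
    by (intro integrable_times_continuous g k hI \<phi>_cont)+
  define F where "F = (\<lambda>x. (h x - g x) * deriv \<phi> x + k x * \<phi> x)"
  have F: "integrable ?M F"
    unfolding F_def using ints by (simp add: left_diff_distrib)
  have FU: "set_integrable lebesgue U F"
  proof (rule set_integrable_subset[OF _ U_sets U_sub])
    show "set_integrable lebesgue {a<..<b} F"
      unfolding set_integrable_def by (rule iffD1[OF integrable_restrict_space F]) simp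
  qed
  have comp0: "(LINT x:C|lebesgue. F x) = 0" if C: "C \<in> components U" for C
  proof -
    have "bounded U" using U_sub bounded_subset[of "{a<..<b}" U] by simp
    then obtain \<alpha> \<beta> where \<alpha>\<beta>: "\<alpha> < \<beta>" "C = {\<alpha><..<\<beta>}" "\<alpha> \<notin> U" "\<beta> \<notin> U"
      using component_of_bounded_open_real[OF \<open>open U\<close> _ C] by blast
    have CU: "{\<alpha><..<\<beta>} \<subseteq> U" using in_components_subset[OF C] \<alpha>\<beta> by simp
    have sub: "{\<alpha><..<\<beta>} \<subseteq> {a<..<b}" using CU U_sub by simp
    then have ends: "a \<le> \<alpha>" "\<beta> \<le> b"
      using \<alpha>\<beta>(1) by (auto simp: greaterThanLessThan_subseteq_greaterThanLessThan)
    have g': "integrable (lebesgue_on {\<alpha><..<\<beta>}) g" and k': "integrable (lebesgue_on {\<alpha><..<\<beta>}) k"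
      by (rule integrable_lebesgue_on_subset[of "{a<..<b}"]; use g k sub in simp)+
    have means: "mean g p q = mean g q r" if "\<alpha> < p" "p < q" "q < r" "r < \<beta>" for p q r
    proof (rule antisym)
      show "mean g p q \<le> mean g q r" by (rule convex) (use that ends in auto)
      show "mean g q r \<le> mean g p q"
      proof (rule affine)
        have "{p..r} \<subseteq> U" using that CU by fastforce
        then show "\<forall>x\<in>{p..r}. w x < 0" by (auto simp: U_def)
      qed (use that ends in auto)
    qed
    obtain s where AE: "AE x in lebesgue_on {\<alpha><..<\<beta>}. g x = s"
      and s: "\<And>p q. \<alpha> \<le> p \<Longrightarrow> p < q \<Longrightarrow> q \<le> \<beta> \<Longrightarrow> mean g p q = s"
      using AE_constant_if_means_equal[OF \<alpha>\<beta>(1) g' means] by blast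
    have left: "(h \<alpha> - s) * \<phi> \<alpha> = 0"
    proof (cases "\<alpha> = a")
      case True then show ?thesis using test_functions_boundary[OF \<phi>] by simp
    next
      case False
      then have "a < \<alpha>" "\<alpha> < b" using ends \<alpha>\<beta>(1) by auto
      moreover from this have "w \<alpha> = 0" using \<alpha>\<beta>(3) nonpos[of \<alpha>] by (auto simp: U_def)
      ultimately have "h \<alpha> = s"
        using contact_slope_agrees(1)[OF h incr nonpos convex, of \<alpha> \<beta> s] s \<alpha>\<beta>(1) ends by auto
      then show ?thesis by simp
    qed
    have right: "(h \<beta> - s) * \<phi> \<beta> = 0"
    proof (cases "\<beta> = b")
      case True then show ?thesis using test_functions_boundary[OF \<phi>] by simp
    next
      case False
      then have "a < \<beta>" "\<beta> < b" using ends \<alpha>\<beta>(1) by auto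
      moreover from this have "w \<beta> = 0" using \<alpha>\<beta>(4) nonpos[of \<beta>] by (auto simp: U_def)
      ultimately have "h \<beta> = s"
        using contact_slope_agrees(2)[OF h incr nonpos convex, of \<beta> \<alpha> s] s \<alpha>\<beta>(1) ends by auto
      then show ?thesis by simp
    qed
    have hx: "h x - s = (h \<alpha> - s) + integral {\<alpha>..x} k" if "x \<in> {\<alpha>..\<beta>}" for x
      using primitive_diff[OF k, of \<alpha> x] that ends by (auto simp: h_def)
    have "(LINT x:C|lebesgue. F x) = (LINT x|lebesgue_on {\<alpha><..<\<beta>}. F x)"
      unfolding \<alpha>\<beta>(2) set_lebesgue_integral_def by (subst integral_restrict_space) auto
    also have "\<dots> = (LINT x|lebesgue_on {\<alpha><..<\<beta>}. ((h \<alpha> - s) + integral {\<alpha>..x} k) * deriv \<phi> x + k x * \<phi> x)"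
    proof (rule integral_cong_AE)
      show "F \<in> borel_measurable (lebesgue_on {\<alpha><..<\<beta>})"
        using integrable_lebesgue_on_subset[OF F sub] by auto
      show "(\<lambda>x. ((h \<alpha> - s) + integral {\<alpha>..x} k) * deriv \<phi> x + k x * \<phi> x)
          \<in> borel_measurable (lebesgue_on {\<alpha><..<\<beta>})"
        by (intro borel_measurable_integrable Bochner_Integration.integrable_add
            integrable_times_continuous continuous_imp_integrable_Ioo continuous_intros
            primitive_continuous k' test_functions_continuous[OF \<phi>] test_function_deriv_continuous[OF \<phi>])
      have "AE x in lebesgue_on {\<alpha><..<\<beta>}. x \<in> {\<alpha><..<\<beta>}"
        using AE_space[of "lebesgue_on {\<alpha><..<\<beta>}"] by simp
      with AE show "AE x in lebesgue_on {\<alpha><..<\<beta>}.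
          F x = ((h \<alpha> - s) + integral {\<alpha>..x} k) * deriv \<phi> x + k x * \<phi> x"
      proof eventually_elim
        case (elim x)
        then show ?case using hx[of x] by (simp add: F_def)
      qed
    qed
    also have "\<dots> = (LINT x|lebesgue_on {\<alpha><..<\<beta>}. ((h \<alpha> - s) + integral {\<alpha>..x} k) * deriv \<phi> x)
        + (LINT x|lebesgue_on {\<alpha><..<\<beta>}. k x * \<phi> x)"
      by (intro Bochner_Integration.integral_add
            integrable_times_continuous continuous_imp_integrable_Ioo continuous_intros
            primitive_continuous k' test_functions_continuous[OF \<phi>] test_function_deriv_continuous[OF \<phi>])
    also have "\<dots> = ((h \<alpha> - s) + integral {\<alpha>..\<beta>} k) * \<phi> \<beta> - (h \<alpha> - s) * \<phi> \<alpha>"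
      by (rule primitive_integration_by_parts)
        (use \<alpha>\<beta>(1) k' in \<open>auto intro: test_function_has_deriv[OF \<phi>] test_function_deriv_continuous[OF \<phi>]\<close>)
    also have "(h \<alpha> - s) + integral {\<alpha>..\<beta>} k = h \<beta> - s"
      using hx[of \<beta>] \<alpha>\<beta>(1) by simp
    also have "(h \<beta> - s) * \<phi> \<beta> - (h \<alpha> - s) * \<phi> \<alpha> = 0"
      unfolding left right by simp
    finally show ?thesis .
  qed
  have "(LINT x:U|lebesgue. F x) = 0"
    by (rule integral_zero_if_zero_on_components[OF \<open>open U\<close> FU comp0])
  moreover have "(LINT x:U|lebesgue. F x) = (LINT x|?M. indicator U x * F x)"
    unfolding set_lebesgue_integral_def
    by (subst integral_restrict_space)
      (use U_sub in \<open>auto simp: indicator_def intro!: Bochner_Integration.integral_cong\<close>)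
  ultimately have UF: "(LINT x|?M. indicator U x * F x) = 0" by simp
  define m where "m = (\<lambda>x. indicator (- U) x * k x)"
  (* Off U the factor h - g vanishes almost everywhere, so that only the part of k on the contact set
     is left when the integral over U is written as one over the whole interval. *)
  have U_M: "U \<in> sets ?M"
    using U_sub U_sets by (simp add: sets_restrict_space_iff)
  have m\<phi>: "integrable ?M (\<lambda>x. m x * \<phi> x)"
  proof -
    have "integrable ?M (\<lambda>x. indicator U x *\<^sub>R (k x * \<phi> x))"
      by (rule integrable_mult_indicator[OF U_M ints(3)])
    then have "integrable ?M (\<lambda>x. k x * \<phi> x - indicator U x *\<^sub>R (k x * \<phi> x))"
      using ints(3) by simp
    moreover have "(\<lambda>x. k x * \<phi> x - indicator U x *\<^sub>R (k x * \<phi> x)) = (\<lambda>x. m x * \<phi> x)"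
      by (auto simp: m_def indicator_def)
    ultimately show ?thesis by simp
  qed
  have "(LINT x|?M. indicator U x * F x)
      = (LINT x|?M. (h x * deriv \<phi> x - g x * deriv \<phi> x) + (k x * \<phi> x - m x * \<phi> x))"
  proof (rule integral_cong_AE)
    show "(\<lambda>x. indicator U x * F x) \<in> borel_measurable ?M"
      using borel_measurable_integrable[OF F] U_M by simp
    show "(\<lambda>x. (h x * deriv \<phi> x - g x * deriv \<phi> x) + (k x * \<phi> x - m x * \<phi> x)) \<in> borel_measurable ?M"
      using ints m\<phi> by (intro borel_measurable_integrable) auto
    have "AE x in ?M. x \<in> {a<..<b}"
      using AE_space[of ?M] by simp
    moreover have "AE x in ?M. w x = 0 \<longrightarrow> g x = h x"
      by (rule AE_equal_on_contact_set[OF h g incr nonpos convex])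
    ultimately show "AE x in ?M. indicator U x * F x = (h x * deriv \<phi> x - g x * deriv \<phi> x) + (k x * \<phi> x - m x * \<phi> x)"
    proof eventually_elim
      case (elim x)
      then show ?case
        using nonpos[of x] by (auto simp: F_def m_def U_def indicator_def algebra_simps)
    qed
  qed
  also have "\<dots> = (LINT x|?M. h x * deriv \<phi> x) - (LINT x|?M. g x * deriv \<phi> x)
      + ((LINT x|?M. k x * \<phi> x) - (LINT x|?M. m x * \<phi> x))"
    using ints m\<phi> by simp
  also have "(LINT x|?M. h x * deriv \<phi> x) = - (LINT x|?M. k x * \<phi> x)"
    unfolding h_def by (rule primitive_weak_parts[OF \<phi>]) (use ab k in auto)
  finally show "(LINT x|?M. g x * deriv \<phi> x) = - (LINT x|?M. (indicator (- U) x * k x) * \<phi> x)"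
    using UF by (simp add: m_def)
qed

section \<open>Square-integrable functions and weak derivatives\<close>

lemma L2_measurable: "u \<in> L2_space S \<Longrightarrow> u \<in> borel_measurable (lebesgue_on S)"
  by (simp add: L2_space_def)

lemma L2_product_integrable:
  assumes "u \<in> L2_space S" "v \<in> L2_space S"
  shows "integrable (lebesgue_on S) (\<lambda>x. u x * v x)"
proof (rule Bochner_Integration.integrable_bound)
  show "integrable (lebesgue_on S) (\<lambda>x. (u x)\<^sup>2 + (v x)\<^sup>2)"
    using assms by (simp add: L2_space_def)
  show "AE x in lebesgue_on S. norm (u x * v x) \<le> norm ((u x)\<^sup>2 + (v x)\<^sup>2)"
  proof (rule AE_I2)
    fix x
    have "2 * (\<bar>u x\<bar> * \<bar>v x\<bar>) \<le> (u x)\<^sup>2 + (v x)\<^sup>2"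
      using sum_squares_bound[of "\<bar>u x\<bar>" "\<bar>v x\<bar>"] by simp
    moreover have "0 \<le> \<bar>u x\<bar> * \<bar>v x\<bar>" by simp
    ultimately have "\<bar>u x\<bar> * \<bar>v x\<bar> \<le> (u x)\<^sup>2 + (v x)\<^sup>2" by linarith
    then show "norm (u x * v x) \<le> norm ((u x)\<^sup>2 + (v x)\<^sup>2)"
      by (simp add: abs_mult)
  qed
qed (use assms L2_measurable in auto)

lemma L2_continuous:
  assumes "continuous_on {a..b} v" shows "v \<in> L2_space {a<..<b}"
proof -
  have "integrable (lebesgue_on {a<..<b}) v" "integrable (lebesgue_on {a<..<b}) (\<lambda>x. (v x)\<^sup>2)"
    by (intro continuous_imp_integrable_Ioo continuous_intros assms)+
  then show ?thesis by (simp add: L2_space_def)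
qed

lemma L2_integrable:
  assumes "u \<in> L2_space {a<..<b}" shows "integrable (lebesgue_on {a<..<b}) u"
  using L2_product_integrable[OF assms L2_continuous[of a b "\<lambda>x. 1"]] by simp

lemma L2_lincomb:
  assumes u: "u \<in> L2_space S" and v: "v \<in> L2_space S"
  shows "(\<lambda>x. c * u x + d * v x) \<in> L2_space S"
proof -
  have "integrable (lebesgue_on S) (\<lambda>x. c\<^sup>2 * (u x)\<^sup>2 + d\<^sup>2 * (v x)\<^sup>2 + 2 * c * d * (u x * v x))"
    using L2_product_integrable[OF u v] u v by (simp add: L2_space_def)
  also have "(\<lambda>x. c\<^sup>2 * (u x)\<^sup>2 + d\<^sup>2 * (v x)\<^sup>2 + 2 * c * d * (u x * v x)) = (\<lambda>x. (c * u x + d * v x)\<^sup>2)"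
    by (simp add: power2_eq_square algebra_simps)
  finally show ?thesis
    using L2_measurable[OF u] L2_measurable[OF v] by (simp add: L2_space_def)
qed

lemma L2_add: "u \<in> L2_space S \<Longrightarrow> v \<in> L2_space S \<Longrightarrow> (\<lambda>x. u x + v x) \<in> L2_space S"
  using L2_lincomb[of u S v 1 1] by simp

lemma L2_diff: "u \<in> L2_space S \<Longrightarrow> v \<in> L2_space S \<Longrightarrow> (\<lambda>x. u x - v x) \<in> L2_space S"
  using L2_lincomb[of u S v 1 "-1"] by simp

lemma L2_cmult: "u \<in> L2_space S \<Longrightarrow> (\<lambda>x. c * u x) \<in> L2_space S"
  using L2_lincomb[of u S u c 0] by simp

lemma L2_indicator:
  assumes u: "u \<in> L2_space S" and A: "A \<in> sets lebesgue"
  shows "(\<lambda>x. indicator A x * u x) \<in> L2_space S"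
proof -
  have [measurable]: "indicat_real A \<in> borel_measurable (lebesgue_on S)"
    using A by (intro measurable_restrict_space1) simp
  have [measurable]: "u \<in> borel_measurable (lebesgue_on S)" by (rule L2_measurable[OF u])
  have "integrable (lebesgue_on S) (\<lambda>x. (indicator A x * u x)\<^sup>2)"
  proof (rule Bochner_Integration.integrable_bound)
    show "integrable (lebesgue_on S) (\<lambda>x. (u x)\<^sup>2)" using u by (simp add: L2_space_def)
    show "(\<lambda>x. (indicator A x * u x)\<^sup>2) \<in> borel_measurable (lebesgue_on S)" by measurable
  qed (auto simp: indicator_def)
  then show ?thesis by (simp add: L2_space_def)
qed

lemma test_functions_higher_deriv:
  "\<phi> \<in> test_functions {a<..<b} \<Longrightarrow> a < b \<Longrightarrow> (deriv ^^ k) \<phi> \<in> test_functions {a<..<b}"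
  by (induction k) (auto intro: test_functions_deriv)

lemma has_weak_deriv_L2: "has_weak_deriv S k u g \<Longrightarrow> g \<in> L2_space S"
  by (simp add: has_weak_deriv_def)

lemma has_weak_deriv_0: "u \<in> L2_space S \<Longrightarrow> has_weak_deriv S 0 u u"
  by (simp add: has_weak_deriv_def)

lemma has_weak_deriv_add_order:
  assumes ab: "a < b" and u: "has_weak_deriv {a<..<b} j u g" and g: "has_weak_deriv {a<..<b} k g h"
  shows "has_weak_deriv {a<..<b} (j + k) u h"
  unfolding has_weak_deriv_def
proof (intro conjI ballI)
  show "h \<in> L2_space {a<..<b}" by (rule has_weak_deriv_L2[OF g])
  fix \<phi> assume \<phi>: "\<phi> \<in> test_functions {a<..<b}"
  have "(LINT x|lebesgue_on {a<..<b}. u x * (deriv ^^ (j + k)) \<phi> x)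
      = (LINT x|lebesgue_on {a<..<b}. u x * (deriv ^^ j) ((deriv ^^ k) \<phi>) x)"
    by (simp add: funpow_add)
  also have "\<dots> = (-1) ^ j * (LINT x|lebesgue_on {a<..<b}. g x * (deriv ^^ k) \<phi> x)"
    using u test_functions_higher_deriv[OF \<phi> ab] by (simp add: has_weak_deriv_def)
  also have "(LINT x|lebesgue_on {a<..<b}. g x * (deriv ^^ k) \<phi> x)
      = (-1) ^ k * (LINT x|lebesgue_on {a<..<b}. h x * \<phi> x)"
    using g \<phi> by (simp add: has_weak_deriv_def)
  finally show "(LINT x|lebesgue_on {a<..<b}. u x * (deriv ^^ (j + k)) \<phi> x)
      = (-1) ^ (j + k) * (LINT x|lebesgue_on {a<..<b}. h x * \<phi> x)"
    by (simp add: power_add)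
qed

text \<open>
  Derivatives of test functions are test functions; this makes the weak second derivative the weak
  derivative of the weak first derivative, which the definition does not say directly.
\<close>

lemma has_weak_deriv_diff_order:
  assumes ab: "a < b" and u: "has_weak_deriv {a<..<b} j u g" and h: "has_weak_deriv {a<..<b} (j + k) u h"
  shows "has_weak_deriv {a<..<b} k g h"
  unfolding has_weak_deriv_def
proof (intro conjI ballI)
  show "h \<in> L2_space {a<..<b}" by (rule has_weak_deriv_L2[OF h])
  fix \<phi> assume \<phi>: "\<phi> \<in> test_functions {a<..<b}"
  have "(-1) ^ j * (LINT x|lebesgue_on {a<..<b}. g x * (deriv ^^ k) \<phi> x)
      = (LINT x|lebesgue_on {a<..<b}. u x * (deriv ^^ j) ((deriv ^^ k) \<phi>) x)"
    using u test_functions_higher_deriv[OF \<phi> ab] by (simp add: has_weak_deriv_def)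
  also have "\<dots> = (-1) ^ (j + k) * (LINT x|lebesgue_on {a<..<b}. h x * \<phi> x)"
    using h \<phi> by (simp add: has_weak_deriv_def funpow_add)
  finally show "(LINT x|lebesgue_on {a<..<b}. g x * (deriv ^^ k) \<phi> x)
      = (-1) ^ k * (LINT x|lebesgue_on {a<..<b}. h x * \<phi> x)"
    by (simp add: power_add)
qed

lemma has_weak_deriv_lincomb:
  assumes ab: "a < b" and u: "integrable (lebesgue_on {a<..<b}) u" and v: "integrable (lebesgue_on {a<..<b}) v"
    and ug: "has_weak_deriv {a<..<b} k u g" and vh: "has_weak_deriv {a<..<b} k v h"
  shows "has_weak_deriv {a<..<b} k (\<lambda>x. c * u x + d * v x) (\<lambda>x. c * g x + d * h x)"
  unfolding has_weak_deriv_def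
proof (intro conjI ballI)
  show "(\<lambda>x. c * g x + d * h x) \<in> L2_space {a<..<b}"
    by (intro L2_lincomb has_weak_deriv_L2[OF ug] has_weak_deriv_L2[OF vh])
  fix \<phi> assume \<phi>: "\<phi> \<in> test_functions {a<..<b}"
  note cont = test_functions_continuous[OF \<phi>] test_functions_continuous[OF test_functions_higher_deriv[OF \<phi> ab]]
  have ints: "integrable (lebesgue_on {a<..<b}) (\<lambda>x. u x * (deriv ^^ k) \<phi> x)"
     "integrable (lebesgue_on {a<..<b}) (\<lambda>x. v x * (deriv ^^ k) \<phi> x)"
     "integrable (lebesgue_on {a<..<b}) (\<lambda>x. g x * \<phi> x)" "integrable (lebesgue_on {a<..<b}) (\<lambda>x. h x * \<phi> x)"
    by (intro integrable_times_continuous u v cont L2_integrable has_weak_deriv_L2[OF ug] has_weak_deriv_L2[OF vh])+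
  have "(LINT x|lebesgue_on {a<..<b}. (c * u x + d * v x) * (deriv ^^ k) \<phi> x)
      = (LINT x|lebesgue_on {a<..<b}. c * (u x * (deriv ^^ k) \<phi> x) + d * (v x * (deriv ^^ k) \<phi> x))"
    by (simp add: algebra_simps)
  also have "\<dots> = c * (LINT x|lebesgue_on {a<..<b}. u x * (deriv ^^ k) \<phi> x)
      + d * (LINT x|lebesgue_on {a<..<b}. v x * (deriv ^^ k) \<phi> x)"
    using ints by simp
  also have "\<dots> = (-1) ^ k * (c * (LINT x|lebesgue_on {a<..<b}. g x * \<phi> x) + d * (LINT x|lebesgue_on {a<..<b}. h x * \<phi> x))"
    using ug vh \<phi> by (simp add: has_weak_deriv_def algebra_simps)
  also have "\<dots> = (-1) ^ k * (LINT x|lebesgue_on {a<..<b}. c * (g x * \<phi> x) + d * (h x * \<phi> x))"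
    using ints by simp
  also have "\<dots> = (-1) ^ k * (LINT x|lebesgue_on {a<..<b}. (c * g x + d * h x) * \<phi> x)"
    by (simp add: algebra_simps)
  finally show "(LINT x|lebesgue_on {a<..<b}. (c * u x + d * v x) * (deriv ^^ k) \<phi> x)
      = (-1) ^ k * (LINT x|lebesgue_on {a<..<b}. (c * g x + d * h x) * \<phi> x)" .
qed

lemma has_weak_deriv_primitive:
  assumes "a < b" and k: "k \<in> L2_space {a<..<b}"
  shows "has_weak_deriv {a<..<b} 1 (\<lambda>x. c + integral {a..x} k) k"
  unfolding has_weak_deriv_def
proof (intro conjI ballI k)
  fix \<phi> assume "\<phi> \<in> test_functions {a<..<b}"
  from primitive_weak_parts[OF this _ L2_integrable[OF k], of c] assms(1)
  show "(LINT x|lebesgue_on {a<..<b}. (c + integral {a..x} k) * (deriv ^^ 1) \<phi> x)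
      = (-1) ^ 1 * (LINT x|lebesgue_on {a<..<b}. k x * \<phi> x)"
    by simp
qed

lemma has_weak_deriv_unique:
  assumes ab: "a < b" and g: "has_weak_deriv {a<..<b} k u g" and h: "has_weak_deriv {a<..<b} k u h"
  shows "AE x in lebesgue_on {a<..<b}. g x = h x"
proof -
  note gh = L2_integrable[OF has_weak_deriv_L2[OF g]] L2_integrable[OF has_weak_deriv_L2[OF h]]
  have "AE x in lebesgue_on {a<..<b}. g x - h x = 0"
  proof (rule fundamental_lemma_calculus_of_variations)
    fix \<phi> assume \<phi>: "\<phi> \<in> test_functions {a<..<b}"
    have "(-1) ^ k * (LINT x|lebesgue_on {a<..<b}. g x * \<phi> x) = (-1) ^ k * (LINT x|lebesgue_on {a<..<b}. h x * \<phi> x)"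
      using g[unfolded has_weak_deriv_def, THEN conjunct2, rule_format, OF \<phi>]
        h[unfolded has_weak_deriv_def, THEN conjunct2, rule_format, OF \<phi>] by simp
    moreover have "integrable (lebesgue_on {a<..<b}) (\<lambda>x. g x * \<phi> x)" "integrable (lebesgue_on {a<..<b}) (\<lambda>x. h x * \<phi> x)"
      by (intro integrable_times_continuous gh test_functions_continuous[OF \<phi>])+
    ultimately show "(LINT x|lebesgue_on {a<..<b}. (g x - h x) * \<phi> x) = 0"
      by (simp add: left_diff_distrib)
  qed (use gh in auto)
  then show ?thesis by simp
qed

lemma weak_derivI:
  assumes "u \<in> sobolev_H m S" "j \<le> m"
  shows "has_weak_deriv S j u (weak_deriv S j u)"
proof -
  have "\<exists>g. has_weak_deriv S j u g"
    using assms by (simp add: sobolev_H_def)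
  then show ?thesis
    unfolding weak_deriv_def by (rule someI_ex)
qed

lemma weak_deriv_AE_eq:
  assumes "a < b" "has_weak_deriv {a<..<b} k u g"
  shows "AE x in lebesgue_on {a<..<b}. weak_deriv {a<..<b} k u x = g x"
proof (rule has_weak_deriv_unique[OF assms(1) _ assms(2)])
  show "has_weak_deriv {a<..<b} k u (weak_deriv {a<..<b} k u)"
    unfolding weak_deriv_def by (rule someI[of "has_weak_deriv {a<..<b} k u", OF assms(2)])
qed

text \<open>
  The difference of the function and the primitive of its weak derivative has weak derivative
  zero.
\<close>

lemma primitive_representation:
  assumes ab: "a < b" and u: "integrable (lebesgue_on {a<..<b}) u"
    and g: "has_weak_deriv {a<..<b} 1 u g"
  obtains c where "AE x in lebesgue_on {a<..<b}. u x = c + integral {a..x} g"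
proof -
  have gI: "integrable (lebesgue_on {a<..<b}) g" by (rule L2_integrable[OF has_weak_deriv_L2[OF g]])
  have PI: "integrable (lebesgue_on {a<..<b}) (\<lambda>x. integral {a..x} g)"
    by (intro continuous_imp_integrable_Ioo primitive_continuous gI)
  have "(LINT x|lebesgue_on {a<..<b}. (u x - integral {a..x} g) * deriv \<phi> x) = 0"
    if \<phi>: "\<phi> \<in> test_functions {a<..<b}" for \<phi>
  proof -
    have "integrable (lebesgue_on {a<..<b}) (\<lambda>x. u x * deriv \<phi> x)"
      "integrable (lebesgue_on {a<..<b}) (\<lambda>x. integral {a..x} g * deriv \<phi> x)"
      by (intro integrable_times_continuous u PI test_function_deriv_continuous[OF \<phi>])+
    moreover have "(LINT x|lebesgue_on {a<..<b}. u x * deriv \<phi> x) = - (LINT x|lebesgue_on {a<..<b}. g x * \<phi> x)"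
      using g \<phi> by (simp add: has_weak_deriv_def)
    moreover have "(LINT x|lebesgue_on {a<..<b}. integral {a..x} g * deriv \<phi> x) = - (LINT x|lebesgue_on {a<..<b}. g x * \<phi> x)"
      using primitive_weak_parts[OF \<phi> _ gI, of 0] ab by simp
    ultimately show ?thesis by (simp add: left_diff_distrib)
  qed
  then obtain c where "AE x in lebesgue_on {a<..<b}. u x - integral {a..x} g = c"
    using du_Bois_Reymond[OF ab Bochner_Integration.integrable_diff[OF u PI]] by blast
  then have "AE x in lebesgue_on {a<..<b}. u x = c + integral {a..x} g"
    by eventually_elim auto
  then show thesis by (rule that)
qed

lemma continuous_eq_if_AE_eq:
  fixes v w :: "real \<Rightarrow> real"
  assumes ab: "a < b" and v: "continuous_on {a..b} v" and w: "continuous_on {a..b} w"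
    and AE: "AE x in lebesgue_on {a<..<b}. v x = w x" and x: "x \<in> {a..b}"
  shows "v x = w x"
proof -
  define D where "D = {a<..<b} \<inter> (\<lambda>x. v x - w x) -` (- {0})"
  have "open D"
    unfolding D_def
    by (rule continuous_open_preimage)
      (auto intro!: continuous_intros continuous_on_subset[OF v] continuous_on_subset[OF w])
  have "D = {}"
  proof (rule ccontr)
    assume "D \<noteq> {}"
    then obtain c d where cd: "c < d" "{c<..<d} \<subseteq> D"
      using \<open>open D\<close> openE[of D] by (metis all_not_in_conv ball_eq_greaterThanLessThan less_add_same_cancel1 diff_less_eq order_less_trans)
    have "AE x in lebesgue. x \<notin> {c<..<d}"
      using AE cd(2) by (auto simp: AE_restrict_space_iff D_def elim!: eventually_mono)
    then have "{c<..<d} \<in> null_sets lebesgue"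
      by (simp add: AE_iff_null_sets)
    then show False using cd by (simp add: null_sets_def)
  qed
  then have "\<And>x. x \<in> {a<..<b} \<Longrightarrow> v x - w x = 0" by (auto simp: D_def)
  moreover have "closure {a<..<b} = {a..b}" using ab by simp
  ultimately have "v x - w x = 0"
    using continuous_constant_on_closure[of "{a<..<b}" "\<lambda>x. v x - w x" 0 x] x v w
    by (auto intro!: continuous_intros)
  then show ?thesis by simp
qed

text \<open>
  Two continuous functions that agree almost everywhere agree on the closed interval, so the choice
  made in the definition of the continuous representative does not matter.
\<close>

lemma cont_rep_eq:
  assumes ab: "a < b" and v: "continuous_on {a..b} v"
    and AE: "AE x in lebesgue_on {a<..<b}. u x = v x" and x: "x \<in> {a..b}"
  shows "cont_rep {a<..<b} u x = v x"
proof -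
  have cl: "closure {a<..<b} = {a..b}" using ab by simp
  have "continuous_on (closure {a<..<b}) v \<and> (AE x in lebesgue_on {a<..<b}. v x = u x)"
    using v AE cl by (auto elim: eventually_mono)
  then have "continuous_on (closure {a<..<b}) (cont_rep {a<..<b} u) \<and>
      (AE x in lebesgue_on {a<..<b}. cont_rep {a<..<b} u x = u x)"
    unfolding cont_rep_def
    by (rule someI[of "\<lambda>g. continuous_on (closure {a<..<b}) g \<and> (AE x in lebesgue_on {a<..<b}. g x = u x)"])
  then have "continuous_on {a..b} (cont_rep {a<..<b} u)" "AE x in lebesgue_on {a<..<b}. cont_rep {a<..<b} u x = v x"
    using AE cl by (auto elim: eventually_elim2)
  then show ?thesis
    using continuous_eq_if_AE_eq[OF ab _ v _ x] by blast
qed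

section \<open>Hat functions\<close>

text \<open>
  The piecewise linear function that rises from \<open>0\<close> at \<open>p\<close> to \<open>1\<close> at \<open>q\<close> and is constant outside
  \<open>[p,q]\<close>. The difference of two adjacent ramps is a hat with peak \<open>1\<close>.
\<close>

definition ramp :: "real \<Rightarrow> real \<Rightarrow> real \<Rightarrow> real" where
  "ramp p q x = max 0 (min x q - p) / (q - p)"

lemma integral_indicator_ramp:
  fixes p q :: real
  assumes "a \<le> p" "p < q"
  shows "integral {a..x} (\<lambda>t. indicator {p..q} t / (q - p)) = ramp p q x"
proof -
  have "integral {a..x} (indicat_real {p..q}) = integral {a..x} (\<lambda>t. if t \<in> {p..q} then 1 else 0)"
    by (intro Henstock_Kurzweil_Integration.integral_cong) (simp add: indicator_def)
  also have "\<dots> = integral ({p..q} \<inter> {a..x}) (\<lambda>t. 1)"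
    using integral_restrict_Int[of "{a..x}" "{p..q}" "\<lambda>t. 1::real"] by (simp add: Int_commute)
  also have "{p..q} \<inter> {a..x} = {p..min x q}" using assms by auto
  also have "integral {p..min x q} (\<lambda>t. 1::real) = max 0 (min x q - p)"
    by (cases "p \<le> min x q") auto
  finally show ?thesis by (simp add: ramp_def)
qed

lemma ramp_bounds:
  assumes "p < q"
  shows "0 \<le> ramp p q x" "ramp p q x \<le> 1" "x \<le> p \<Longrightarrow> ramp p q x = 0" "q \<le> x \<Longrightarrow> ramp p q x = 1"
  using assms by (auto simp: ramp_def min_def max_def)

definition hat_slope :: "real \<Rightarrow> real \<Rightarrow> real \<Rightarrow> real \<Rightarrow> real" where
  "hat_slope p q r t = indicator {p..q} t / (q - p) - indicator {q..r} t / (r - q)"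

lemma integrable_on_indicator_Icc:
  fixes p q :: real
  shows "indicat_real {p..q} integrable_on {a..x}"
proof (rule integrable_eq)
  show "(\<lambda>t. if t \<in> {p..q} then 1 else 0::real) integrable_on {a..x}"
    by (subst integrable_restrict_Int) (simp add: integrable_const_ivl)
qed (simp add: indicator_def)

lemma integral_hat_slope:
  assumes "a \<le> p" "p < q" "q < r"
  shows "integral {a..x} (hat_slope p q r) = ramp p q x - ramp q r x"
  unfolding hat_slope_def
  using assms integral_indicator_ramp[of a p q x] integral_indicator_ramp[of a q r x]
  by (subst Henstock_Kurzweil_Integration.integral_diff) (auto intro!: integrable_on_indicator_Icc integrable_on_divide)

lemma hat_bounds:
  assumes "p < q" "q < r"
  shows "0 \<le> ramp p q x - ramp q r x" "ramp p q x - ramp q r x \<le> 1"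
    "x \<notin> {p..r} \<Longrightarrow> ramp p q x - ramp q r x = 0"
proof -
  note R = ramp_bounds[OF assms(1), of x] ramp_bounds[OF assms(2), of x]
  show "0 \<le> ramp p q x - ramp q r x" using R by (cases "x \<le> q") auto
  show "ramp p q x - ramp q r x \<le> 1" using R by auto
  show "x \<notin> {p..r} \<Longrightarrow> ramp p q x - ramp q r x = 0" using R assms by auto
qed

lemma hat_slope_L2: "hat_slope p q r \<in> L2_space {a<..<b}"
proof -
  have "(\<lambda>t. indicator {p..q} t * (1 / (q - p)) - indicator {q..r} t * (1 / (r - q))) \<in> L2_space {a<..<b}"
    by (intro L2_diff L2_indicator L2_continuous) auto
  then show ?thesis by (simp add: hat_slope_def[abs_def])
qed

text \<open>
  Testing with hats turns the inequality into a comparison of adjacent means.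
\<close>

lemma integral_against_hat_slope:
  assumes g: "integrable (lebesgue_on {a<..<b}) g" and pqr: "a < p" "p < q" "q < r" "r < b"
  shows "(LINT x|lebesgue_on {a<..<b}. g x * hat_slope p q r x) = mean g p q - mean g q r"
proof -
  have *: "integrable (lebesgue_on {a<..<b}) (\<lambda>x. indicator {c..d} x * g x)"
    "(LINT x|lebesgue_on {a<..<b}. indicator {c..d} x * g x) = integral {c..d} g"
    if "a < c" "c < d" "d < b" for c d
  proof -
    have "{c..d} \<in> sets (lebesgue_on {a<..<b})"
      using that by (auto simp: sets_restrict_space_iff)
    then show "integrable (lebesgue_on {a<..<b}) (\<lambda>x. indicator {c..d} x * g x)"
      using integrable_mult_indicator[OF _ g] by fastforce
    have gcd: "integrable (lebesgue_on {c..d}) g"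
      by (rule integrable_lebesgue_on_subset[OF g]) (use that in auto)
    have "(LINT x|lebesgue_on {a<..<b}. indicator {c..d} x * g x)
      = (LINT x|lebesgue_on {c..d}. g x)"
      using that by (subst (1 2) integral_restrict_space)
        (auto simp: indicator_def intro!: Bochner_Integration.integral_cong)
    also have "\<dots> = integral {c..d} g"
      using gcd by (simp add: lebesgue_integral_eq_integral)
    finally show "(LINT x|lebesgue_on {a<..<b}. indicator {c..d} x * g x) = integral {c..d} g" .
  qed
  have "(LINT x|lebesgue_on {a<..<b}. g x * hat_slope p q r x)
      = (LINT x|lebesgue_on {a<..<b}. indicator {p..q} x * g x / (q - p) - indicator {q..r} x * g x / (r - q))"
    by (simp add: hat_slope_def algebra_simps)
  also have "\<dots> = mean g p q - mean g q r"
    using *[of p q] *[of q r] pqr by (simp add: mean_def)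
  finally show ?thesis .
qed

section \<open>The variational inequality\<close>

theorem theorem2p8:
  fixes I :: "real set" and V K :: "(real \<Rightarrow> real) set"
    and y\<^sub>d f \<psi> ybar :: "real \<Rightarrow> real" and \<beta> :: real
  assumes I: "I = {-1<..<1}"
    and yd: "y\<^sub>d \<in> L2_space I"
    and beta: "\<beta> > 0"
    and f: "f \<in> sobolev_H 1 I"
    and psi: "\<psi> \<in> sobolev_H 2 I"
    and psi1: "cont_rep I \<psi> 1 \<ge> 0"
    and V: "V = {v \<in> sobolev_H 2 I. cont_rep I v (-1) = 0 \<and> cont_rep I (weak_deriv I 1 v) 1 = 0}"
    and K: "K = {y \<in> V. \<forall>x\<in>I. cont_rep I (weak_deriv I 1 y) x \<le> cont_rep I \<psi> x}"
    and ybar: "ybar \<in> K"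
    and VI: "\<forall>y\<in>K.
      (LINT x|lebesgue_on I. (ybar x - y\<^sub>d x) * (y x - ybar x)) +
      \<beta> * (LINT x|lebesgue_on I.
             (weak_deriv I 2 ybar x + f x) * (weak_deriv I 2 y x - weak_deriv I 2 ybar x)) \<ge> 0"
  shows "ybar \<in> sobolev_H 3 I"
proof -
  have lt: "(-1::real) < 1" by simp
  note yd = yd[unfolded I] and f = f[unfolded I] and psi = psi[unfolded I]
  let ?I = "{-1<..<1::real}" and ?M = "lebesgue_on {-1<..<1::real}"
  define d1 d2 where "d1 = weak_deriv ?I 1 ybar" and "d2 = weak_deriv ?I 2 ybar"
  have H2: "ybar \<in> sobolev_H 2 ?I" and ybar0: "cont_rep ?I ybar (-1) = 0" and d1_1: "cont_rep ?I d1 1 = 0"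
    and obst: "\<And>x. x \<in> ?I \<Longrightarrow> cont_rep ?I d1 x \<le> cont_rep ?I \<psi> x"
    using ybar by (auto simp: K V I d1_def)
  have wd1: "has_weak_deriv ?I 1 ybar d1" and wd2: "has_weak_deriv ?I 2 ybar d2"
    unfolding d1_def d2_def by (rule weak_derivI[OF H2]; simp)+
  have wd12: "has_weak_deriv ?I 1 d1 d2"
    by (rule has_weak_deriv_diff_order[OF lt wd1]) (use wd2 in \<open>simp add: numeral_2_eq_2\<close>)
  have ybar_L2: "ybar \<in> L2_space ?I" using H2 by (simp add: sobolev_H_def)
  have d_L2: "d1 \<in> L2_space ?I" "d2 \<in> L2_space ?I"
    using wd1 wd2 has_weak_deriv_L2 by blast+

  define \<psi>1 \<psi>2 where "\<psi>1 = weak_deriv ?I 1 \<psi>" and "\<psi>2 = weak_deriv ?I 2 \<psi>"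
  have w\<psi>1: "has_weak_deriv ?I 1 \<psi> \<psi>1" and w\<psi>2: "has_weak_deriv ?I 2 \<psi> \<psi>2"
    unfolding \<psi>1_def \<psi>2_def by (rule weak_derivI[OF psi]; simp)+
  have w\<psi>12: "has_weak_deriv ?I 1 \<psi>1 \<psi>2"
    by (rule has_weak_deriv_diff_order[OF lt w\<psi>1]) (use w\<psi>2 in \<open>simp add: numeral_2_eq_2\<close>)
  have \<psi>_L2: "\<psi> \<in> L2_space ?I" "\<psi>1 \<in> L2_space ?I" "\<psi>2 \<in> L2_space ?I"
    using psi w\<psi>1 w\<psi>2 has_weak_deriv_L2 by (auto simp: sobolev_H_def)
  define f1 where "f1 = weak_deriv ?I 1 f"
  have wf1: "has_weak_deriv ?I 1 f f1"
    unfolding f1_def by (rule weak_derivI[OF f]) simp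
  have f_L2: "f \<in> L2_space ?I" "f1 \<in> L2_space ?I"
    using f wf1 has_weak_deriv_L2 by (auto simp: sobolev_H_def)

  obtain c0 where c0: "AE x in ?M. ybar x = c0 + integral {-1..x} d1"
    using primitive_representation[OF lt L2_integrable[OF ybar_L2] wd1] .
  obtain c1 where c1: "AE x in ?M. d1 x = c1 + integral {-1..x} d2"
    using primitive_representation[OF lt L2_integrable[OF d_L2(1)] wd12] .
  obtain c\<psi> where c\<psi>: "AE x in ?M. \<psi> x = c\<psi> + integral {-1..x} \<psi>1"
    using primitive_representation[OF lt L2_integrable[OF \<psi>_L2(1)] w\<psi>1] .
  obtain c\<psi>1 where c\<psi>1: "AE x in ?M. \<psi>1 x = c\<psi>1 + integral {-1..x} \<psi>2"
    using primitive_representation[OF lt L2_integrable[OF \<psi>_L2(2)] w\<psi>12] .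
  obtain cf where cf: "AE x in ?M. f x = cf + integral {-1..x} f1"
    using primitive_representation[OF lt L2_integrable[OF f_L2(1)] wf1] .

  define p where "p = (\<lambda>x. c1 + integral {-1..x} d2)"
  define \<Psi> where "\<Psi> = (\<lambda>x. c\<psi> + integral {-1..x} \<psi>1)"
  have cont_prim: "continuous_on {-1..1} (\<lambda>x. c + integral {-1..x} u)" if "u \<in> L2_space ?I" for u and c :: real
    by (intro continuous_intros primitive_continuous L2_integrable that)
  have p_cont: "continuous_on {-1..1} p" and \<Psi>_cont: "continuous_on {-1..1} \<Psi>"
    unfolding p_def \<Psi>_def by (intro cont_prim d_L2 \<psi>_L2)+
  have rep_p: "cont_rep ?I d1 x = p x" and rep_\<Psi>: "cont_rep ?I \<psi> x = \<Psi> x" if "x \<in> {-1..1}" for x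
    using cont_rep_eq[OF lt p_cont _ that, of d1] cont_rep_eq[OF lt \<Psi>_cont _ that, of \<psi>] c1 c\<psi>
    by (auto simp: p_def \<Psi>_def)
  have c0_0: "c0 = 0"
    using cont_rep_eq[OF lt cont_prim[OF d_L2(1), of c0] c0, of "-1"] ybar0 by simp
  have p1: "p 1 = 0" using rep_p[of 1] d1_1 by simp
  have p_le: "p x \<le> \<Psi> x" if "x \<in> ?I" for x
    using obst[OF that] rep_p[of x] rep_\<Psi>[of x] that by auto

  define u where "u = (\<lambda>x. ybar x - y\<^sub>d x)"
  have u_L2: "u \<in> L2_space ?I" unfolding u_def by (intro L2_diff ybar_L2 yd)
  define \<Phi> where "\<Phi> = (\<lambda>x. integral {-1..1} u - integral {-1..x} u)"
  have \<Phi>_cont: "continuous_on {-1..1} \<Phi>"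
    unfolding \<Phi>_def by (intro continuous_intros primitive_continuous L2_integrable u_L2)
  have \<Phi>_L2: "\<Phi> \<in> L2_space ?I" by (rule L2_continuous[OF \<Phi>_cont])
  define \<Phi>1 where "\<Phi>1 = (\<lambda>x. integral {-1..x} \<Phi>)"
  have \<Phi>1_cont: "continuous_on {-1..1} \<Phi>1"
    unfolding \<Phi>1_def by (intro primitive_continuous L2_integrable \<Phi>_L2)
  have \<Phi>1_L2: "\<Phi>1 \<in> L2_space ?I" by (rule L2_continuous[OF \<Phi>1_cont])
  define g where "g = (\<lambda>x. d2 x + f x - \<Phi>1 x / \<beta>)"
  have g_L2: "g \<in> L2_space ?I"
    unfolding g_def using L2_diff[OF L2_add[OF d_L2(2) f_L2(1)] L2_cmult[OF \<Phi>1_L2, of "1/\<beta>"]] by simp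
  note g_int = L2_integrable[OF g_L2]

  (* The competitor is the solution plus the second primitive of e; e must have integral zero to keep
     the boundary condition at 1, while the condition at -1 is preserved automatically. *)
  have variation: "0 \<le> (LINT x|?M. g x * e x)"
    if e: "e \<in> L2_space ?I" and e1: "integral {-1..1} e = 0"
      and adm: "\<And>x. x \<in> ?I \<Longrightarrow> p x + integral {-1..x} e \<le> \<Psi> x" for e
  proof -
    define \<eta> where "\<eta> = (\<lambda>x. integral {-1..x} e)"
    have \<eta>_cont: "continuous_on {-1..1} \<eta>"
      unfolding \<eta>_def by (intro primitive_continuous L2_integrable e)
    have \<eta>_L2: "\<eta> \<in> L2_space ?I" by (rule L2_continuous[OF \<eta>_cont])
    define E where "E = (\<lambda>x. integral {-1..x} \<eta>)"
    have E_cont: "continuous_on {-1..1} E"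
      unfolding E_def by (intro primitive_continuous L2_integrable \<eta>_L2)
    have E_L2: "E \<in> L2_space ?I" by (rule L2_continuous[OF E_cont])
    define y where "y = (\<lambda>x. ybar x + E x)"
    have y_L2: "y \<in> L2_space ?I" unfolding y_def by (intro L2_add ybar_L2 E_L2)
    have wE1: "has_weak_deriv ?I 1 E \<eta>"
      using has_weak_deriv_primitive[OF lt \<eta>_L2, of 0] by (simp add: E_def)
    have "has_weak_deriv ?I 1 \<eta> e"
      using has_weak_deriv_primitive[OF lt e, of 0] by (simp add: \<eta>_def)
    from has_weak_deriv_add_order[OF lt wE1 this]
    have wE2: "has_weak_deriv ?I 2 E e" by (simp add: numeral_2_eq_2)
    note lin = has_weak_deriv_lincomb[OF lt L2_integrable[OF ybar_L2] L2_integrable[OF E_L2], where c=1 and d=1]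
    have wy1: "has_weak_deriv ?I 1 y (\<lambda>x. d1 x + \<eta> x)"
      using lin[OF wd1 wE1] by (simp add: y_def)
    have wy2: "has_weak_deriv ?I 2 y (\<lambda>x. d2 x + e x)"
      using lin[OF wd2 wE2] by (simp add: y_def)
    have yH2: "y \<in> sobolev_H 2 ?I"
      unfolding sobolev_H_def
    proof (intro CollectI conjI allI impI y_L2)
      fix j :: nat assume "j \<le> 2"
      then consider "j = 0" | "j = 1" | "j = 2" by linarith
      then show "\<exists>g. has_weak_deriv ?I j y g"
        using has_weak_deriv_0[OF y_L2] wy1 wy2 by cases auto
    qed
    have "AE x in ?M. y x = integral {-1..x} d1 + E x"
      using c0 by eventually_elim (simp add: y_def c0_0)
    then have "cont_rep ?I y (-1) = integral {-1..-1} d1 + E (-1)"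
      by (intro cont_rep_eq lt) (auto intro!: continuous_intros E_cont primitive_continuous L2_integrable d_L2)
    then have y0: "cont_rep ?I y (-1) = 0" by (simp add: E_def)
    have rep_y: "cont_rep ?I (weak_deriv ?I 1 y) x = p x + \<eta> x" if "x \<in> {-1..1}" for x
    proof (rule cont_rep_eq[OF lt _ _ that])
      show "continuous_on {-1..1} (\<lambda>x. p x + \<eta> x)" by (intro continuous_intros p_cont \<eta>_cont)
      show "AE x in ?M. weak_deriv ?I 1 y x = p x + \<eta> x"
        using weak_deriv_AE_eq[OF lt wy1] c1 by eventually_elim (simp add: p_def)
    qed
    have yK: "y \<in> K"
      using yH2 y0 rep_y[of 1] p1 e1 adm rep_y rep_\<Psi> by (auto simp: K V I \<eta>_def)
    have VIy: "0 \<le> (LINT x|?M. u x * E x)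
        + \<beta> * (LINT x|?M. (d2 x + f x) * (weak_deriv ?I 2 y x - d2 x))"
      using bspec[OF VI yK] by (simp add: I u_def d2_def y_def)
    have "(LINT x|?M. (d2 x + f x) * (weak_deriv ?I 2 y x - d2 x)) = (LINT x|?M. (d2 x + f x) * e x)"
    proof (rule integral_cong_AE)
      have "has_weak_deriv ?I 2 y (weak_deriv ?I 2 y)" by (rule weak_derivI[OF yH2]) simp
      then show "(\<lambda>x. (d2 x + f x) * (weak_deriv ?I 2 y x - d2 x)) \<in> borel_measurable ?M"
        using d_L2 f_L2 L2_measurable has_weak_deriv_L2
        by (intro borel_measurable_times borel_measurable_add borel_measurable_diff) blast+
      show "(\<lambda>x. (d2 x + f x) * e x) \<in> borel_measurable ?M"
        using d_L2 f_L2 e L2_measurable by (intro borel_measurable_times borel_measurable_add) blast+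
      show "AE x in ?M. (d2 x + f x) * (weak_deriv ?I 2 y x - d2 x) = (d2 x + f x) * e x"
        using weak_deriv_AE_eq[OF lt wy2] by eventually_elim simp
    qed
    moreover have "(LINT x|?M. u x * E x) = - (LINT x|?M. \<Phi>1 x * e x)"
    proof -
      have "(LINT x|?M. integral {-1..x} u * \<eta> x) + (LINT x|?M. u x * E x) = integral {-1..1} u * E 1"
        using primitive_product[OF L2_integrable[OF u_L2] L2_integrable[OF \<eta>_L2]] by (simp add: E_def)
      moreover have "integral {-1..1} u * E 1 = (LINT x|?M. integral {-1..1} u * \<eta> x)"
        using integral_lebesgue_on_eq_HK[OF L2_integrable[OF \<eta>_L2]] by (simp add: E_def)
      moreover have "(LINT x|?M. \<Phi> x * \<eta> x)
          = (LINT x|?M. integral {-1..1} u * \<eta> x) - (LINT x|?M. integral {-1..x} u * \<eta> x)"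
      proof -
        have "integrable ?M (\<lambda>x. integral {-1..1} u * \<eta> x)"
          using L2_integrable[OF \<eta>_L2] by simp
        moreover have "integrable ?M (\<lambda>x. integral {-1..x} u * \<eta> x)"
          by (intro continuous_imp_integrable_Ioo continuous_intros primitive_continuous L2_integrable u_L2 \<eta>_cont)
        ultimately show ?thesis by (simp add: \<Phi>_def left_diff_distrib)
      qed
      moreover have "(LINT x|?M. \<Phi>1 x * e x) + (LINT x|?M. \<Phi> x * \<eta> x) = 0"
        using primitive_product[OF L2_integrable[OF \<Phi>_L2] L2_integrable[OF e]] e1 by (simp add: \<Phi>1_def \<eta>_def)
      ultimately show ?thesis by linarith
    qed
    moreover have "\<beta> * (LINT x|?M. g x * e x)
        = \<beta> * (LINT x|?M. (d2 x + f x) * e x) - (LINT x|?M. \<Phi>1 x * e x)"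
    proof -
      have "(LINT x|?M. g x * e x) = (LINT x|?M. (d2 x + f x) * e x - (\<Phi>1 x * e x) / \<beta>)"
        by (simp add: g_def algebra_simps)
      also have "\<dots> = (LINT x|?M. (d2 x + f x) * e x) - (LINT x|?M. \<Phi>1 x * e x) / \<beta>"
        using L2_product_integrable[OF L2_add[OF d_L2(2) f_L2(1)] e] L2_product_integrable[OF \<Phi>1_L2 e] by simp
      finally show ?thesis using beta by (simp only: right_diff_distrib) simp
    qed
    ultimately have "0 \<le> \<beta> * (LINT x|?M. g x * e x)" using VIy by simp
    then show ?thesis using beta by (simp add: zero_le_mult_iff)
  qed

  have convex: "mean g a b \<le> mean g b c" if abc: "-1 < a" "a < b" "b < c" "c < 1" for a b c
  proof -
    have "0 \<le> (LINT x|?M. g x * ((-1) * hat_slope a b c x))"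
    proof (rule variation)
      show "(\<lambda>x. (-1) * hat_slope a b c x) \<in> L2_space ?I" by (intro L2_cmult hat_slope_L2)
      show "integral {-1..1} (\<lambda>x. (-1) * hat_slope a b c x) = 0"
        using hat_bounds(3)[of a b c 1] integral_hat_slope[of "-1" a b c 1] abc by simp
      show "p x + integral {-1..x} (\<lambda>x. (-1) * hat_slope a b c x) \<le> \<Psi> x" if "x \<in> ?I" for x
        using hat_bounds(1)[of a b c x] integral_hat_slope[of "-1" a b c x] abc p_le[OF that] by simp
    qed
    then show ?thesis
      using integral_against_hat_slope[OF g_int abc] by simp
  qed
  define w where "w = (\<lambda>x. p x - \<Psi> x)"
  have w_cont: "continuous_on {-1..1} w"
    unfolding w_def by (intro continuous_intros p_cont \<Psi>_cont)
  have affine: "mean g b c \<le> mean g a b"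
    if abc: "-1 < a" "a < b" "b < c" "c < 1" and neg: "\<forall>x\<in>{a..c}. w x < 0" for a b c
  proof -
    have "continuous_on {a..c} w"
      by (rule continuous_on_subset[OF w_cont]) (use abc in auto)
    then obtain z where z: "z \<in> {a..c}" "\<And>x. x \<in> {a..c} \<Longrightarrow> w x \<le> w z"
      using continuous_attains_sup[of "{a..c}" w] abc by auto
    (* By compactness the obstacle is at distance at least \<delta> on the support of the hat. *)
    define \<delta> where "\<delta> = - w z"
    have \<delta>: "\<delta> > 0" using z neg by (simp add: \<delta>_def)
    have "0 \<le> (LINT x|?M. g x * (\<delta> * hat_slope a b c x))"
    proof (rule variation)
      show "(\<lambda>x. \<delta> * hat_slope a b c x) \<in> L2_space ?I" by (intro L2_cmult hat_slope_L2)
      show "integral {-1..1} (\<lambda>x. \<delta> * hat_slope a b c x) = 0"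
        using hat_bounds(3)[of a b c 1] integral_hat_slope[of "-1" a b c 1] abc by simp
      show "p x + integral {-1..x} (\<lambda>x. \<delta> * hat_slope a b c x) \<le> \<Psi> x" if x: "x \<in> ?I" for x
      proof (cases "x \<in> {a..c}")
        case True
        have "\<delta> * (ramp a b x - ramp b c x) \<le> \<delta> * 1"
          by (rule mult_left_mono) (use hat_bounds(2)[of a b c x] abc \<delta> in auto)
        then show ?thesis
          using z(2)[OF True] integral_hat_slope[of "-1" a b c x] abc by (simp add: w_def \<delta>_def)
      next
        case False
        then show ?thesis
          using hat_bounds(3)[of a b c x] integral_hat_slope[of "-1" a b c x] abc p_le[OF x] by simp
      qed
    qed
    then have "0 \<le> \<delta> * (mean g a b - mean g b c)"
      using integral_against_hat_slope[OF g_int abc] by (simp add: mult.left_commute)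
    then show ?thesis using \<delta> by (simp add: zero_le_mult_iff)
  qed

  define k where "k = (\<lambda>x. \<psi>2 x + f1 x - \<Phi> x / \<beta>)"
  have k_L2: "k \<in> L2_space ?I"
    unfolding k_def using L2_diff[OF L2_add[OF \<psi>_L2(3) f_L2(2)] L2_cmult[OF \<Phi>_L2, of "1/\<beta>"]] by simp
  define h where "h = (\<lambda>x. (c\<psi>1 + cf) + integral {-1..x} k)"
  have h_cont: "continuous_on {-1..1} h"
    unfolding h_def by (intro cont_prim k_L2)
  have h_eq: "AE x in ?M. h x = \<psi>1 x + f x - \<Phi>1 x / \<beta>"
  proof -
    have *: "integral {-1..x} k = integral {-1..x} \<psi>2 + integral {-1..x} f1 - integral {-1..x} \<Phi> / \<beta>"
      if "x \<in> ?I" for x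
    proof -
      have "\<psi>2 integrable_on {-1..x}" "f1 integrable_on {-1..x}" "\<Phi> integrable_on {-1..x}"
        by (rule integrable_imp_integrable_on[OF L2_integrable[of _ "-1" 1]];
            use \<psi>_L2 f_L2 \<Phi>_L2 that in auto)+
      then show ?thesis
        unfolding k_def
        by (simp add: Henstock_Kurzweil_Integration.integral_diff Henstock_Kurzweil_Integration.integral_add
            integrable_add integrable_on_divide)
    qed
    have "AE x in ?M. x \<in> ?I" using AE_space[of ?M] by simp
    with c\<psi>1 cf show ?thesis
      by eventually_elim (simp add: h_def * \<Phi>1_def)
  qed
  have incr: "w y - w x = integral {x..y} g - integral {x..y} h" if xy: "-1 \<le> x" "x \<le> y" "y \<le> 1" for x y
  proof -
    have ion: "v integrable_on {x..y}" if "v \<in> L2_space ?I" for v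
      by (rule integrable_imp_integrable_on[OF L2_integrable[OF that]]) (use xy in auto)
    have "w y - w x = integral {x..y} d2 - integral {x..y} \<psi>1"
      using primitive_diff[OF L2_integrable[OF d_L2(2)] xy] primitive_diff[OF L2_integrable[OF \<psi>_L2(2)] xy]
      by (simp add: w_def p_def \<Psi>_def)
    also have "\<dots> = integral {x..y} (\<lambda>t. d2 t - \<psi>1 t)"
      by (intro Henstock_Kurzweil_Integration.integral_diff[symmetric] ion d_L2 \<psi>_L2)
    also have "\<dots> = integral {x..y} (\<lambda>t. g t - h t)"
    proof (rule integral_eq_if_AE_eq)
      show "integrable ?M (\<lambda>t. d2 t - \<psi>1 t)" "integrable ?M (\<lambda>t. g t - h t)"
        by (intro L2_integrable L2_diff d_L2 \<psi>_L2 g_L2 L2_continuous[OF h_cont])+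
      show "AE t in ?M. d2 t - \<psi>1 t = g t - h t"
        using h_eq by eventually_elim (simp add: g_def)
    qed (use xy in auto)
    also have "\<dots> = integral {x..y} g - integral {x..y} h"
      by (intro Henstock_Kurzweil_Integration.integral_diff ion g_L2 L2_continuous[OF h_cont])
    finally show ?thesis .
  qed
  define U where "U = {x \<in> ?I. w x < 0}"
  have w_le: "w x \<le> 0" if "-1 < x" "x < 1" for x
    using p_le[of x] that by (simp add: w_def)
  have "open U"
    unfolding U_def by (rule open_negativity_set[OF w_cont])
  define m where "m = (\<lambda>x. indicator (- U) x * k x)"
  have m_L2: "m \<in> L2_space ?I"
    unfolding m_def by (rule L2_indicator[OF k_L2]) (use \<open>open U\<close> in auto)
  have wg: "has_weak_deriv ?I 1 g m"
    unfolding has_weak_deriv_def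
  proof (intro conjI ballI m_L2)
    fix \<phi> assume \<phi>: "\<phi> \<in> test_functions ?I"
    have "(LINT x|?M. g x * deriv \<phi> x) = - (LINT x|?M. m x * \<phi> x)"
      unfolding m_def U_def
      by (rule obstacle_weak_derivative[OF lt g_int L2_integrable[OF k_L2]
            incr[unfolded h_def] w_le convex affine \<phi>])
    then show "(LINT x|?M. g x * (deriv ^^ 1) \<phi> x) = (-1) ^ 1 * (LINT x|?M. m x * \<phi> x)"
      by simp
  qed
  have w\<Phi>1: "has_weak_deriv ?I 1 \<Phi>1 \<Phi>"
    using has_weak_deriv_primitive[OF lt \<Phi>_L2, of 0] by (simp add: \<Phi>1_def)
  have "has_weak_deriv ?I 1 (\<lambda>x. 1 * (1 * g x + (-1) * f x) + (1 / \<beta>) * \<Phi>1 x)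
      (\<lambda>x. 1 * (1 * m x + (-1) * f1 x) + (1 / \<beta>) * \<Phi> x)"
    by (intro has_weak_deriv_lincomb lt L2_integrable L2_lincomb g_L2 f_L2 \<Phi>1_L2 wg wf1 w\<Phi>1)
  then have "has_weak_deriv ?I 1 d2 (\<lambda>x. m x - f1 x + \<Phi> x / \<beta>)"
    by (simp add: g_def)
  from has_weak_deriv_add_order[OF lt wd2 this]
  have wd3: "has_weak_deriv ?I 3 ybar (\<lambda>x. m x - f1 x + \<Phi> x / \<beta>)"
    by (simp add: numeral_3_eq_3)
  show ?thesis
    unfolding I sobolev_H_def
  proof (intro CollectI conjI allI impI ybar_L2)
    fix j :: nat assume "j \<le> 3"
    then consider "j = 0" | "j = 1" | "j = 2" | "j = 3" by linarith
    then show "\<exists>g. has_weak_deriv ?I j ybar g"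
      using has_weak_deriv_0[OF ybar_L2] wd1 wd2 wd3 by cases auto
  qed
qed

end
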